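(* Consider, for every $m\in\mathbb{N}$, the model $y_m=A_mx_m^*+\varepsilon_m$ with $A_m\in\mathbb{R}^{m\times m}$ and $\varepsilon_m\sim\mathcal{N}(0,\sigma^2I_m)$, where $\sigma^2>0$ does not depend on $m$, and suppose that the singular values of $A_m$ satisfy $1=\gamma_{1,m}\ge\gamma_{2,m}\ge\dots\ge\gamma_{m,m}\ge 0$. Then for any sequence of vectors $(x_m^* )_{m\in\mathbb{N}}$, $x_m^*\in\mathbb{R}^m$, such that $\|x_m^*\|_2^2=O(m)$, we have, as $m\to\infty$, $$\sup_{\alpha\in[0,\infty)}\Bigl|\frac1m\bigl(\mathrm{DP}_m(\alpha,y_m)-\mathrm{EDP}_m(\alpha)\bigr)\Bigr|=O_{\mathbb{P}}\Bigl(\frac{1}{\sqrt m}\Bigr)$$ and $$\mathbb{E}\Biggl[\biggl(\sup_{\alpha\in[0,\infty)}\Bigl|\frac1m\bigl(\mathrm{DP}_m(\alpha,y_m)-\mathrm{EDP}_m(\alpha)\bigr)\Bigr|\biggr)^2\Biggr]=O\Bigl(\frac1m\Bigr).$$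
   Context: Tikhonov estimator: for $\alpha>0$, $\hat x_\alpha(y)=(A_m^{T}A_m+\alpha I)^{-1}A_m^{T}y$; for $\alpha=0$ all quantities are understood as limits $\alpha\downarrow0$ (so $\hat x_0(y)=A_m^{+}y$ with $A_m^+$ the Moore–Penrose pseudoinverse). Discrepancy principle function: $\mathrm{DP}_m(\alpha,y)=\|A_m\hat x_\alpha(y)-y\|_2^2-m\sigma^2$. Equivalently, with a singular value decomposition $A_m=U\Sigma V^{T}$, $\Sigma=\mathrm{diag}(\gamma_{1,m},\dots,\gamma_{m,m})$, $u_i$ the columns of $U$ and $y_i=\langle u_i,y\rangle$, $$\mathrm{DP}_m(\alpha,y)=\sum_{i=1}^m\frac{\alpha^2}{(\gamma_{i,m}^2+\alpha)^2}y_i^2-m\sigma^2.$$ Its expectation is $\mathrm{EDP}_m(\alpha)=\mathbb{E}[\mathrm{DP}_m(\alpha,y_m)]$. Stochastic order symbol: for random variables $Z_m$ and positive numbers $r_m$, $Z_m=O_{\mathbb{P}}(r_m)$ means $\lim_{T\to\infty}\limsup_{m\to\infty}\mathbb{P}(|Z_m|>Tr_m)=0$. *)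

theory Defs
  imports
    "HOL-Probability.Probability"
    "HOL-Library.Landau_Symbols"
    "Jordan_Normal_Form.Char_Poly"
    "Jordan_Normal_Form.Gauss_Jordan_Elimination"
begin

unbundle no vec_syntax
unbundle no inner_syntax

(* From here on vec, mat, det etc. are the notions of Jordan_Normal_Form.Matrix,
   whose dimension is a value; entries are indexed from 0. *)

definition l2_norm :: "real vec \<Rightarrow> real" where
  "l2_norm v = sqrt (v \<bullet> v)"

definition inv_mat :: "real mat \<Rightarrow> real mat" where
  "inv_mat B = the (mat_inverse B)"

(* gam 1, ..., gam n (n the number of columns) are the singular values of A with
   multiplicity, in arbitrary order: the nonnegative square roots of the eigenvalues of A^T A. *)
definition has_singular_values :: "real mat \<Rightarrow> (nat \<Rightarrow> real) \<Rightarrow> bool" where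
  "has_singular_values A gam \<longleftrightarrow>
     (\<forall>i\<in>{1..dim_col A}. 0 \<le> gam i) \<and>
     char_poly (transpose_mat A * A) = (\<Prod>i\<in>{1..dim_col A}. [:- ((gam i)\<^sup>2), 1:])"

(* Lebesgue density of N(mu, S) for positive definite S. *)
definition multivariate_normal_density :: "real vec \<Rightarrow> real mat \<Rightarrow> real vec \<Rightarrow> real" where
  "multivariate_normal_density mu S z =
     exp (- ((z - mu) \<bullet> (inv_mat S *\<^sub>v (z - mu))) / 2) / sqrt ((2 * pi) ^ dim_vec mu * det S)"

(* The law of a random vector is expressed through its coordinate tuple, since the type of
   vectors of unspecified dimension carries no sigma-algebra. *)
definition multivariate_normal ::
  "'a measure \<Rightarrow> ('a \<Rightarrow> real vec) \<Rightarrow> real vec \<Rightarrow> real mat \<Rightarrow> bool" where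
  "multivariate_normal M X mu S \<longleftrightarrow>
     (\<forall>w\<in>space M. X w \<in> carrier_vec (dim_vec mu)) \<and>
     distributed M (\<Pi>\<^sub>M i\<in>{..<dim_vec mu}. lborel)
       (\<lambda>w. \<lambda>i\<in>{..<dim_vec mu}. X w $ i)
       (\<lambda>z. ennreal (multivariate_normal_density mu S (vec (dim_vec mu) z)))"

definition tikhonov_pos :: "real mat \<Rightarrow> real \<Rightarrow> real vec \<Rightarrow> real vec" where
  "tikhonov_pos A \<alpha> y =
     inv_mat (transpose_mat A * A + \<alpha> \<cdot>\<^sub>m 1\<^sub>m (dim_col A)) *\<^sub>v (transpose_mat A *\<^sub>v y)"

(* For \<alpha> = 0 the estimator is the limit \<alpha> \<down> 0, taken coordinatewise
   (it equals the pseudoinverse of A applied to y). *)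
definition tikhonov :: "real mat \<Rightarrow> real \<Rightarrow> real vec \<Rightarrow> real vec" where
  "tikhonov A \<alpha> y =
     (if \<alpha> = 0 then vec (dim_col A) (\<lambda>i. Lim (at_right 0) (\<lambda>a. tikhonov_pos A a y $ i))
      else tikhonov_pos A \<alpha> y)"

definition DP :: "real \<Rightarrow> real mat \<Rightarrow> real \<Rightarrow> real vec \<Rightarrow> real" where
  "DP \<sigma> A \<alpha> y = (l2_norm (A *\<^sub>v tikhonov A \<alpha> y - y))\<^sup>2 - real (dim_row A) * \<sigma>\<^sup>2"

definition EDP :: "'a measure \<Rightarrow> real \<Rightarrow> real mat \<Rightarrow> ('a \<Rightarrow> real vec) \<Rightarrow> real \<Rightarrow> real" where
  "EDP M \<sigma> A Y \<alpha> = (\<integral>w. DP \<sigma> A \<alpha> (Y w) \<partial>M)"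

definition DP_deviation ::
  "'a measure \<Rightarrow> real \<Rightarrow> real mat \<Rightarrow> ('a \<Rightarrow> real vec) \<Rightarrow> real \<Rightarrow> 'a \<Rightarrow> real" where
  "DP_deviation M \<sigma> A Y \<alpha> w =
     \<bar>1 / real (dim_row A) * (DP \<sigma> A \<alpha> (Y w) - EDP M \<sigma> A Y \<alpha>)\<bar>"

definition sup_DP_deviation ::
  "'a measure \<Rightarrow> real \<Rightarrow> real mat \<Rightarrow> ('a \<Rightarrow> real vec) \<Rightarrow> 'a \<Rightarrow> real" where
  "sup_DP_deviation M \<sigma> A Y w = (SUP \<alpha>\<in>{0..}. DP_deviation M \<sigma> A Y \<alpha> w)"

(* Z m = O_P(r m); the variables Z m may live on different probability spaces M m. *)
definition bigO_prob ::
  "(nat \<Rightarrow> 'a measure) \<Rightarrow> (nat \<Rightarrow> 'a \<Rightarrow> real) \<Rightarrow> (nat \<Rightarrow> real) \<Rightarrow> bool" where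
  "bigO_prob M Z r \<longleftrightarrow>
     ((\<lambda>T. limsup (\<lambda>m. ereal (measure (M m) {w \<in> space (M m). \<bar>Z m w\<bar> > T * r m})))
        \<longlongrightarrow> 0) at_top"

end

theory Submission
  imports Defs "Jordan_Normal_Form.Schur_Decomposition"
begin

text \<open>In an orthonormal eigenbasis \<open>u\<close> of \<open>A A\<^sup>T\<close>, ordered by increasing eigenvalue, the centred
  discrepancy is \<open>\<Sum>i. q\<^sub>i(\<alpha>) Z\<^sub>i\<close>. The variables \<open>Z\<^sub>i = (u\<^sub>i \<bullet> y)\<^sup>2 - E (u\<^sub>i \<bullet> y)\<^sup>2\<close> are independent and
  centred by rotation invariance of the noise, and the weights lie in \<open>[0, 1]\<close> and decrease in \<open>i\<close>
  for every \<open>\<alpha>\<close>. Summation by parts bounds the supremum over \<open>\<alpha>\<close> by the largest partial sum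
  \<open>\<bar>Z\<^sub>0 + \<dots> + Z\<^sub>k\<bar>\<close>, whose second moment is at most a constant times \<open>\<Sum>i. Var Z\<^sub>i\<close> by Doob's
  inequality, and this sum is \<open>O(m)\<close> because the singular values are at most 1. The stochastic bound
  follows by Markov's inequality.\<close>

section \<open>Orthogonal diagonalization of symmetric matrices\<close>

text \<open>The parameter \<alpha> ranges over an uncountable set, so no union bound is available.
  What replaces it is that one ordering of the basis makes the weights monotone for every \<alpha>
  at once: a single random variable, the largest partial sum, then controls all \<alpha> together.
  The weight belonging to an eigenvalue l is the square of 1 - l / (l + \<alpha>), the fraction of
  that component which the estimator leaves unfitted. It falls as l grows, hence the increasing
  order. An eigenbasis of A A^T can stand in for a full singular value decomposition because the
  residual lives in the data space; right singular directions enter only through the vectors A^T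
  u_i. With b_i the coordinates of A x, the variance of Z_i is 2 \<sigma>^4 + 4 \<sigma>^2 b_i^2.
  The b_i^2 add up to |A x|^2 \<le> |x|^2, which is where the bound on the signal enters. Two
  further obstacles are not probabilistic estimates: the value at \<alpha> = 0, defined by a limit,
  has to obey the same formula as \<alpha> > 0, and the supremum has to be measurable, which follows
  from continuity in \<alpha> up to and including 0.\<close>

lemma conjugate_real_vec [simp]: "conjugate (v :: real vec) = v"
  by (rule eq_vecI) auto

lemma scalar_prod_self_nonneg: "0 \<le> v \<bullet> (v :: real vec)"
  by (auto simp: scalar_prod_def intro: sum_nonneg)

lemma scalar_prod_self_eq_0_iff: "v \<in> carrier_vec n \<Longrightarrow> v \<bullet> v = 0 \<longleftrightarrow> v = 0\<^sub>v n" for v :: "real vec"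
  using conjugate_square_eq_0_vec[of v n] by simp

text \<open>The fundamental theorem of algebra yields a complex eigenvalue \<open>z\<close> with
  eigenvector \<open>v\<close>. Moving the real symmetric matrix from one side of
  \<open>v \<bullet> conjugate v\<close> to the other turns \<open>z\<close> into
  \<open>cnj z\<close>, so \<open>z\<close> is real and is a root of the real characteristic
  polynomial.\<close>

lemma symmetric_mat_eigenvalue_exists:
  fixes B :: "real mat"
  assumes B: "B \<in> carrier_mat n n" and sym: "transpose_mat B = B" and n: "n > 0"
  shows "\<exists>e. eigenvalue B e"
proof -
  let ?C = "map_mat complex_of_real B"
  have C: "?C \<in> carrier_mat n n" using B by auto
  have symC: "transpose_mat ?C = ?C"
    using sym by (metis map_mat_transpose)
  have "degree (char_poly ?C) = n" using degree_monic_char_poly[OF C] by simp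
  then have "\<not> constant (poly (char_poly ?C))" using n by (simp add: constant_degree)
  then obtain z where z: "poly (char_poly ?C) z = 0"
    using fundamental_theorem_of_algebra by blast
  then have "eigenvalue ?C z" using eigenvalue_root_char_poly[OF C] by simp
  then obtain v where v: "v \<in> carrier_vec n" "v \<noteq> 0\<^sub>v n" and ev: "?C *\<^sub>v v = z \<cdot>\<^sub>v v"
    using C unfolding eigenvalue_def eigenvector_def by auto
  have cv: "conjugate v \<in> carrier_vec n" using v by simp
  have cC: "?C *\<^sub>v conjugate v = conjugate (?C *\<^sub>v v)"
    using B v by (intro eq_vecI) (auto simp: scalar_prod_def sum_conjugate)
  have q: "v \<bullet> conjugate v \<noteq> 0" using conjugate_square_eq_0_vec[OF v(1)] v(2) by simp
  have "z * (v \<bullet> conjugate v) = (?C *\<^sub>v v) \<bullet> conjugate v"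
    unfolding ev using v cv by simp
  also have "\<dots> = v \<bullet> (?C *\<^sub>v conjugate v)"
    using transpose_vec_mult_scalar[OF C cv v(1)] symC by simp
  also have "?C *\<^sub>v conjugate v = cnj z \<cdot>\<^sub>v conjugate v"
    unfolding cC ev by (rule eq_vecI) (auto simp: conjugate_dist_mul)
  also have "v \<bullet> \<dots> = cnj z * (v \<bullet> conjugate v)"
    using v cv by simp
  finally have "z = cnj z" using q by simp
  then obtain r where r: "z = complex_of_real r"
    by (metis Reals_cases Reals_cnj_iff)
  have "poly (char_poly ?C) z = complex_of_real (poly (char_poly B) r)"
    unfolding r of_real_hom.char_poly_hom[OF B] by simp
  then show ?thesis using z eigenvalue_root_char_poly[OF B] by auto
qed

text \<open>Complete \<open>v\<close> to a basis and orthogonalize: Gram-Schmidt leaves the head of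
  the list unchanged, so after normalization column 0 is still a multiple of
  \<open>v\<close>.\<close>

lemma orthogonal_mat_with_first_col:
  fixes v :: "real vec"
  assumes v: "v \<in> carrier_vec n" "v \<noteq> 0\<^sub>v n"
  shows "\<exists>W c. W \<in> carrier_mat n n \<and> transpose_mat W * W = 1\<^sub>m n \<and> col W 0 = c \<cdot>\<^sub>v v"
proof -
  interpret cof_vec_space n "TYPE(real)" .
  define b where "b = basis_completion v"
  define ws where "ws = gram_schmidt n b"
  from basis_completion[OF v, folded b_def]
  have dist_b: "distinct b" and indep: "\<not> lin_dep (set b)" and b: "set b \<subseteq> carrier_vec n"
    and hdb: "hd b = v" and len_b: "length b = n" by auto
  have n: "n > 0" using v by (cases n) auto
  from hdb len_b n obtain vs where bv: "b = v # vs" by (cases b) auto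
  from gram_schmidt_result[OF b dist_b indep refl, folded ws_def]
  have ws: "set ws \<subseteq> carrier_vec n" "corthogonal ws" "length ws = n" by (auto simp: len_b)
  from gram_schmidt_hd[OF v(1), of vs, folded bv] have "hd ws = v" unfolding ws_def .
  then have ws0: "ws ! 0 = v" using ws n by (metis hd_conv_nth list.size(3) less_irrefl)
  have wsn: "ws ! i \<in> carrier_vec n" if "i < n" for i using ws that by auto
  have orth: "ws ! i \<bullet> ws ! j = 0 \<longleftrightarrow> i \<noteq> j" if "i < n" "j < n" for i j
    using corthogonalD[OF ws(2), of i j] that ws(3) by simp
  define d where "d i = 1 / sqrt (ws ! i \<bullet> ws ! i)" for i
  define W where "W = mat_of_cols n (map (\<lambda>i. d i \<cdot>\<^sub>v ws ! i) [0..<n])"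
  have W: "W \<in> carrier_mat n n" unfolding W_def by auto
  have colW: "col W i = d i \<cdot>\<^sub>v ws ! i" if "i < n" for i
    unfolding W_def using that wsn[OF that] by (subst col_mat_of_cols) auto
  have "transpose_mat W * W = 1\<^sub>m n"
  proof (rule eq_matI)
    fix i j assume "i < dim_row (1\<^sub>m n :: real mat)" "j < dim_col (1\<^sub>m n :: real mat)"
    then have ij: "i < n" "j < n" by auto
    have "(transpose_mat W * W) $$ (i, j) = d i * d j * (ws ! i \<bullet> ws ! j)"
      using W ij wsn by (simp add: colW smult_scalar_prod_distrib[of _ n] scalar_prod_smult_distrib[of _ n])
    also have "\<dots> = (if i = j then 1 else 0)"
    proof (cases "i = j")
      case True
      have "ws ! i \<bullet> ws ! i > 0"
        using orth[OF ij(1) ij(1)] scalar_prod_self_nonneg[of "ws ! i"] by simp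
      then show ?thesis using True by (simp add: d_def)
    qed (use orth ij in auto)
    finally show "(transpose_mat W * W) $$ (i, j) = 1\<^sub>m n $$ (i, j)" using ij by simp
  qed (use W in auto)
  moreover have "col W 0 = d 0 \<cdot>\<^sub>v v" using colW[OF n] ws0 by simp
  ultimately show ?thesis using W by blast
qed

text \<open>Deflation. An orthogonal \<open>W\<close> whose column 0 is an eigenvector makes column
  0 of W^T B W vanish below the diagonal, and symmetry carries this over to row 0. The induction
  hypothesis diagonalizes the remaining block by \<open>V\<close>, and \<open>W\<close> times the
  block matrix diag(1, V) diagonalizes \<open>B\<close>.\<close>

theorem symmetric_mat_orthogonal_diagonalization:
  fixes B :: "real mat"
  assumes "B \<in> carrier_mat n n" and "transpose_mat B = B"
  shows "\<exists>U lam. U \<in> carrier_mat n n \<and> transpose_mat U * U = 1\<^sub>m n \<and>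
    transpose_mat U * B * U = mat n n (\<lambda>(i, j). if i = j then lam i else (0 :: real))"
  using assms
proof (induction n arbitrary: B)
  case 0
  then show ?case by (intro exI[of _ "1\<^sub>m 0"]) (auto intro!: eq_matI)
next
  case (Suc k B)
  let ?n = "Suc k"
  note B = Suc.prems(1) and sym = Suc.prems(2)
  obtain e where "eigenvalue B e" using symmetric_mat_eigenvalue_exists[OF B sym] by auto
  then obtain v where v: "v \<in> carrier_vec ?n" "v \<noteq> 0\<^sub>v ?n" and ev: "B *\<^sub>v v = e \<cdot>\<^sub>v v"
    using B unfolding eigenvalue_def eigenvector_def by auto
  obtain W c where W: "W \<in> carrier_mat ?n ?n" and WW: "transpose_mat W * W = 1\<^sub>m ?n"
    and W0: "col W 0 = c \<cdot>\<^sub>v v" using orthogonal_mat_with_first_col[OF v] by blast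
  have WT: "transpose_mat W \<in> carrier_mat ?n ?n" using W by simp
  define A' where "A' = transpose_mat W * B * W"
  have A': "A' \<in> carrier_mat ?n ?n" using W B by (auto simp: A'_def)
  have BW: "B * W \<in> carrier_mat ?n ?n" using B W by simp
  have A'_alt: "A' = transpose_mat W * (B * W)"
    unfolding A'_def by (rule assoc_mult_mat[OF WT B W])
  have symA': "transpose_mat A' = A'"
    unfolding A'_alt transpose_mult[OF WT BW] transpose_mult[OF B W] sym transpose_transpose
    by (rule assoc_mult_mat[OF WT B W])
  have BW0: "col (B * W) 0 = e \<cdot>\<^sub>v col W 0"
  proof -
    have "col (B * W) 0 = B *\<^sub>v col W 0" using B W by auto
    also have "\<dots> = c \<cdot>\<^sub>v (e \<cdot>\<^sub>v v)" unfolding W0 using mult_mat_vec[OF B v(1)] ev by simp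
    finally show ?thesis unfolding W0 by (simp add: smult_smult_assoc mult.commute)
  qed
  \<comment> \<open>Column 0 of \<open>W\<close> is an eigenvector, so column 0 of \<open>A'\<close>
    is \<open>e\<close> times column 0 of W^T W, the identity.\<close>
  have A'0: "A' $$ (i, 0) = (if i = 0 then e else 0)" if i: "i < ?n" for i
  proof -
    have "A' $$ (i, 0) = col W i \<bullet> col (B * W) 0"
      unfolding A'_def using assoc_mult_mat[OF WT B W] W B i by simp
    also have "\<dots> = e * (transpose_mat W * W) $$ (i, 0)"
      unfolding BW0 using W i by (simp add: scalar_prod_smult_distrib[of _ ?n])
    finally show ?thesis unfolding WW using i by simp
  qed
  define A3 where "A3 = mat k k (\<lambda>(i, j). A' $$ (Suc i, Suc j))"
  have A3: "A3 \<in> carrier_mat k k" by (simp add: A3_def)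
  have swap: "A' $$ (i, j) = A' $$ (j, i)" if "i < ?n" "j < ?n" for i j
    using that symA' A' by (metis carrier_matD index_transpose_mat(1))
  have "transpose_mat A3 = A3"
    by (rule eq_matI) (auto simp: A3_def intro: swap)
  from Suc.IH[OF A3 this] obtain V lam where V: "V \<in> carrier_mat k k"
    and VV: "transpose_mat V * V = 1\<^sub>m k"
    and VA: "transpose_mat V * A3 * V = mat k k (\<lambda>(i, j). if i = j then lam i else 0)" by blast
  let ?A1 = "mat 1 1 (\<lambda>_. e)"
  have A'_block: "A' = four_block_mat ?A1 (0\<^sub>m 1 k) (0\<^sub>m k 1) A3"
  proof (rule eq_matI)
    fix i j assume "i < dim_row (four_block_mat ?A1 (0\<^sub>m 1 k) (0\<^sub>m k 1) A3)"
      "j < dim_col (four_block_mat ?A1 (0\<^sub>m 1 k) (0\<^sub>m k 1) A3)"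
    then have ij: "i < ?n" "j < ?n" by (auto simp: A3_def)
    then show "A' $$ (i, j) = four_block_mat ?A1 (0\<^sub>m 1 k) (0\<^sub>m k 1) A3 $$ (i, j)"
      using A'0[of i] A'0[of j] swap[of 0 j] by (cases i; cases j) (auto simp: A3_def)
  qed (use A' in \<open>auto simp: A3_def\<close>)
  define F where "F = four_block_mat (1\<^sub>m 1) (0\<^sub>m 1 k) (0\<^sub>m k 1) V"
  have F: "F \<in> carrier_mat ?n ?n" using V unfolding F_def by auto
  have FT: "transpose_mat F = four_block_mat (1\<^sub>m 1) (0\<^sub>m 1 k) (0\<^sub>m k 1) (transpose_mat V)"
    unfolding F_def using V by (subst transpose_four_block_mat) auto
  have FTc: "transpose_mat F \<in> carrier_mat ?n ?n" using F by simp
  have VT: "transpose_mat V \<in> carrier_mat k k" using V by simp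
  have FF: "transpose_mat F * F = 1\<^sub>m ?n"
    unfolding FT unfolding F_def
    by (subst mult_four_block_mat[OF _ _ _ VT _ _ _ V]) (use V VV in auto)
  have FA: "transpose_mat F * A' * F
      = four_block_mat ?A1 (0\<^sub>m 1 k) (0\<^sub>m k 1) (transpose_mat V * A3 * V)"
  proof -
    have VA3: "transpose_mat V * A3 \<in> carrier_mat k k" using VT A3 by simp
    have A1: "?A1 \<in> carrier_mat 1 1" by simp
    have "transpose_mat F * A' = four_block_mat ?A1 (0\<^sub>m 1 k) (0\<^sub>m k 1) (transpose_mat V * A3)"
      unfolding FT A'_block
      by (subst mult_four_block_mat[OF one_carrier_mat zero_carrier_mat zero_carrier_mat VT A1 zero_carrier_mat zero_carrier_mat A3])
        (use VT A3 VA3 in auto)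
    moreover have "four_block_mat ?A1 (0\<^sub>m 1 k) (0\<^sub>m k 1) (transpose_mat V * A3) * F
        = four_block_mat ?A1 (0\<^sub>m 1 k) (0\<^sub>m k 1) (transpose_mat V * A3 * V)"
      unfolding F_def
      by (subst mult_four_block_mat[OF A1 zero_carrier_mat zero_carrier_mat VA3 one_carrier_mat zero_carrier_mat zero_carrier_mat V])
        (use V VA3 in auto)
    ultimately show ?thesis by simp
  qed
  define U where "U = W * F"
  have U: "U \<in> carrier_mat ?n ?n" using W F by (auto simp: U_def)
  have UT: "transpose_mat U = transpose_mat F * transpose_mat W"
    unfolding U_def by (rule transpose_mult[OF W F])
  have "transpose_mat U * U = transpose_mat F * (transpose_mat W * W) * F"
    unfolding UT unfolding U_def using W F WT FTc
    by (simp add: assoc_mult_mat[of _ ?n ?n _ ?n _ ?n])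
  then have 1: "transpose_mat U * U = 1\<^sub>m ?n"
    unfolding WW using FF FTc by simp
  have "transpose_mat U * B * U = transpose_mat F * A' * F"
    unfolding UT unfolding U_def A'_def using W F WT FTc B
    by (simp add: assoc_mult_mat[of _ ?n ?n _ ?n _ ?n])
  also have "\<dots> = mat ?n ?n (\<lambda>(i, j). if i = j then (case i of 0 \<Rightarrow> e | Suc i \<Rightarrow> lam i) else 0)"
    unfolding FA VA by (rule eq_matI) (auto split: nat.splits)
  finally show ?case using U 1 by blast
qed

text \<open>The columns of the diagonalizing matrix are eigenvectors because U U^T = 1 turns U^T B U
  = D into B U = U D. The increasing order is what later makes the weights monotone in the
  index.\<close>

lemma symmetric_mat_sorted_eigenbasis:
  fixes B :: "real mat"
  assumes B: "B \<in> carrier_mat n n" and sym: "transpose_mat B = B"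
  obtains u lam where "\<And>i. i < n \<Longrightarrow> u i \<in> carrier_vec n"
    "\<And>i j. i < n \<Longrightarrow> j < n \<Longrightarrow> u i \<bullet> u j = (if i = j then 1 else 0)"
    "\<And>i. i < n \<Longrightarrow> B *\<^sub>v u i = lam i \<cdot>\<^sub>v u i"
    "\<And>i j. i \<le> j \<Longrightarrow> j < n \<Longrightarrow> lam i \<le> (lam j :: real)"
proof -
  obtain U lam where U: "U \<in> carrier_mat n n" and UU: "transpose_mat U * U = 1\<^sub>m n"
    and diag: "transpose_mat U * B * U = mat n n (\<lambda>(i, j). if i = j then lam i else (0 :: real))"
    using symmetric_mat_orthogonal_diagonalization[OF assms] by blast
  have UT: "transpose_mat U \<in> carrier_mat n n" using U by simp
  have UU': "U * transpose_mat U = 1\<^sub>m n" by (rule mat_mult_left_right_inverse[OF UT U UU])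
  let ?D = "mat n n (\<lambda>(i, j). if i = j then lam i else (0 :: real))"
  have BU: "B * U = U * ?D"
  proof -
    have "U * ?D = U * (transpose_mat U * (B * U))"
      unfolding diag[symmetric] assoc_mult_mat[OF UT B U] ..
    also have "\<dots> = (U * transpose_mat U) * (B * U)"
      by (rule assoc_mult_mat[symmetric, OF U UT]) (use B U in auto)
    finally show ?thesis unfolding UU' using B U by simp
  qed
  \<comment> \<open>Sorting the list of indices by eigenvalue gives a permutation: its entries are
    below \<open>n\<close> and distinct, and reading the eigenvalues along it is monotone.\<close>
  define p where "p = (\<lambda>i. sort_key lam [0..<n] ! i)"
  have len: "length (sort_key lam [0..<n]) = n" by simp
  have p_less: "p i < n" if "i < n" for i
    using nth_mem[of i "sort_key lam [0..<n]"] that unfolding p_def by simp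
  have p_inj: "p i = p j \<longleftrightarrow> i = j" if "i < n" "j < n" for i j
    unfolding p_def by (rule nth_eq_iff_index_eq) (use that in auto)
  have p_mono: "lam (p i) \<le> lam (p j)" if "i \<le> j" "j < n" for i j
    using sorted_nth_mono[OF sorted_sort_key[of lam "[0..<n]"], of i j] that
    by (simp add: p_def)
  show ?thesis
  proof (rule that[of "\<lambda>i. col U (p i)" "\<lambda>i. lam (p i)"])
    fix i j assume ij: "i < n" "j < n"
    have "col U (p i) \<bullet> col U (p j) = (transpose_mat U * U) $$ (p i, p j)"
      using U p_less ij by simp
    then show "col U (p i) \<bullet> col U (p j) = (if i = j then 1 else 0)"
      unfolding UU using p_less p_inj ij by simp
  next
    fix i assume i: "i < n"
    have "B *\<^sub>v col U (p i) = col (B * U) (p i)" using B U p_less[OF i] by auto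
    also have "\<dots> = lam (p i) \<cdot>\<^sub>v col U (p i)"
      unfolding BU using U p_less[OF i]
      by (intro eq_vecI) (auto simp: scalar_prod_def if_distrib sum.If_cases cong: if_cong)
    finally show "B *\<^sub>v col U (p i) = lam (p i) \<cdot>\<^sub>v col U (p i)" .
  qed (use U p_mono in auto)
qed

section \<open>Coordinates with respect to an orthonormal basis\<close>

definition basis_sum :: "nat \<Rightarrow> (nat \<Rightarrow> real vec) \<Rightarrow> (nat \<Rightarrow> real) \<Rightarrow> real vec" where
  "basis_sum n u c = vec n (\<lambda>j. \<Sum>i<n. c i * u i $ j)"

lemma basis_sum_carrier [simp]: "basis_sum n u c \<in> carrier_vec n"
  by (simp add: basis_sum_def)

lemma dim_basis_sum [simp]: "dim_vec (basis_sum n u c) = n"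
  by (simp add: basis_sum_def)

lemma basis_sum_index [simp]: "j < n \<Longrightarrow> basis_sum n u c $ j = (\<Sum>i<n. c i * u i $ j)"
  by (simp add: basis_sum_def)

lemma mult_mat_basis_sum_index:
  assumes A: "A \<in> carrier_mat k n" and u: "\<And>i. i < n \<Longrightarrow> u i \<in> carrier_vec n" and j: "j < k"
  shows "(A *\<^sub>v basis_sum n u c) $ j = (\<Sum>i<n. c i * (A *\<^sub>v u i) $ j)"
proof -
  have "(A *\<^sub>v basis_sum n u c) $ j = (\<Sum>l<n. \<Sum>i<n. A $$ (j, l) * (c i * u i $ l))"
    using A j by (simp add: scalar_prod_def sum_distrib_left atLeast0LessThan)
  also have "\<dots> = (\<Sum>i<n. \<Sum>l<n. A $$ (j, l) * (c i * u i $ l))" by (rule sum.swap)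
  also have "\<dots> = (\<Sum>i<n. c i * (A *\<^sub>v u i) $ j)"
  proof (rule sum.cong[OF refl])
    fix i assume "i \<in> {..<n}"
    then have "dim_vec (u i) = n" using u by auto
    then have "(A *\<^sub>v u i) $ j = (\<Sum>l<n. A $$ (j, l) * u i $ l)"
      using A j by (simp add: scalar_prod_def atLeast0LessThan)
    then show "(\<Sum>l<n. A $$ (j, l) * (c i * u i $ l)) = c i * (A *\<^sub>v u i) $ j"
      by (simp add: sum_distrib_left algebra_simps)
  qed
  finally show ?thesis .
qed

lemma mult_mat_basis_sum_eigen:
  assumes "B \<in> carrier_mat n n" and u: "\<And>i. i < n \<Longrightarrow> u i \<in> carrier_vec n"
    and ev: "\<And>i. i < n \<Longrightarrow> B *\<^sub>v u i = lam i \<cdot>\<^sub>v u i"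
  shows "B *\<^sub>v basis_sum n u c = basis_sum n u (\<lambda>i. c i * lam i)"
proof (rule eq_vecI)
  fix j assume "j < dim_vec (basis_sum n u (\<lambda>i. c i * lam i))"
  then have j: "j < n" by (simp add: basis_sum_def)
  have "(B *\<^sub>v basis_sum n u c) $ j = (\<Sum>i<n. c i * (B *\<^sub>v u i) $ j)"
    by (rule mult_mat_basis_sum_index[OF assms(1) u j])
  also have "\<dots> = (\<Sum>i<n. c i * lam i * u i $ j)"
    using u j by (intro sum.cong refl) (simp add: ev carrier_vecD[OF u])
  finally show "(B *\<^sub>v basis_sum n u c) $ j = basis_sum n u (\<lambda>i. c i * lam i) $ j"
    using j by simp
qed (use assms in \<open>simp add: basis_sum_def\<close>)

locale orthonormal_basis =
  fixes n :: nat and u :: "nat \<Rightarrow> real vec"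
  assumes u_carrier: "i < n \<Longrightarrow> u i \<in> carrier_vec n"
    and u_orthonormal: "i < n \<Longrightarrow> j < n \<Longrightarrow> u i \<bullet> u j = (if i = j then 1 else 0)"
begin

lemma row_orthonormal: "i < n \<Longrightarrow> k < n \<Longrightarrow> (\<Sum>j<n. u i $ j * u k $ j) = (if i = k then 1 else 0)"
  using u_orthonormal[of i k] u_carrier[of k] by (simp add: scalar_prod_def atLeast0LessThan carrier_vecD)

text \<open>Completeness of the system: for square matrices a left inverse is also a right inverse,
  so orthonormality of the vectors passes to the transposed array of entries.\<close>

lemma column_orthonormal:
  assumes "j < n" "k < n"
  shows "(\<Sum>i<n. u i $ j * u i $ k) = (if j = k then 1 else 0)"
proof -
  let ?U = "mat n n (\<lambda>(j, i). u i $ j)"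
  have U: "?U \<in> carrier_mat n n" "transpose_mat ?U \<in> carrier_mat n n" by auto
  have "transpose_mat ?U * ?U = 1\<^sub>m n"
    by (rule eq_matI) (auto simp: scalar_prod_def atLeast0LessThan row_orthonormal)
  from mat_mult_left_right_inverse[OF U(2,1) this]
  have "(?U * transpose_mat ?U) $$ (j, k) = 1\<^sub>m n $$ (j, k)" by simp
  then show ?thesis using assms by (simp add: scalar_prod_def atLeast0LessThan)
qed

lemma expansion:
  assumes z: "z \<in> carrier_vec n"
  shows "basis_sum n u (\<lambda>i. u i \<bullet> z) = z"
proof (rule eq_vecI)
  fix j assume "j < dim_vec z"
  then have j: "j < n" using z by auto
  have "basis_sum n u (\<lambda>i. u i \<bullet> z) $ j = (\<Sum>i<n. \<Sum>k<n. u i $ k * z $ k * u i $ j)"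
    using j z by (simp add: scalar_prod_def atLeast0LessThan sum_distrib_right carrier_vecD)
  also have "\<dots> = (\<Sum>k<n. z $ k * (\<Sum>i<n. u i $ k * u i $ j))"
    by (subst sum.swap) (simp add: sum_distrib_left algebra_simps)
  also have "\<dots> = (\<Sum>k<n. z $ k * (if k = j then 1 else 0))"
    using j by (intro sum.cong refl) (simp add: column_orthonormal)
  also have "\<dots> = z $ j" using j by (simp add: if_distrib cong: if_cong)
  finally show "basis_sum n u (\<lambda>i. u i \<bullet> z) $ j = z $ j" .
qed (use z in \<open>simp add: basis_sum_def\<close>)

lemma basis_sum_scalar_prod: "basis_sum n u c \<bullet> basis_sum n u d = (\<Sum>i<n. c i * d i)"
proof -
  have "basis_sum n u c \<bullet> basis_sum n u d = (\<Sum>j<n. \<Sum>i<n. \<Sum>k<n. c i * d k * (u i $ j * u k $ j))"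
    by (simp add: scalar_prod_def atLeast0LessThan sum_product algebra_simps)
  also have "\<dots> = (\<Sum>i<n. \<Sum>k<n. \<Sum>j<n. c i * d k * (u i $ j * u k $ j))"
    by (rule trans[OF sum.swap]) (rule sum.cong[OF refl], rule sum.swap)
  also have "\<dots> = (\<Sum>i<n. \<Sum>k<n. c i * d k * (if i = k then 1 else 0))"
    by (intro sum.cong refl) (simp add: sum_distrib_left[symmetric] row_orthonormal)
  also have "\<dots> = (\<Sum>i<n. c i * d i)"
    by (intro sum.cong refl) (simp add: if_distrib cong: if_cong)
  finally show ?thesis .
qed

lemma basis_sum_norm: "basis_sum n u c \<bullet> basis_sum n u c = (\<Sum>i<n. (c i)\<^sup>2)"
  by (simp add: basis_sum_scalar_prod power2_eq_square)

lemma parseval: "z \<in> carrier_vec n \<Longrightarrow> (\<Sum>i<n. (u i \<bullet> z)\<^sup>2) = z \<bullet> z"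
  using basis_sum_norm[of "\<lambda>i. u i \<bullet> z"] expansion[of z] by simp

end

section \<open>The Tikhonov estimator in an eigenbasis\<close>

text \<open>The form in which inverses are evaluated here: guess the solution \<open>x\<close>,
  apply \<open>A\<close> to it, and cancel.\<close>

lemma inv_mat_mult_vec:
  assumes A: "A \<in> carrier_mat n n" and det: "det A \<noteq> 0" and x: "x \<in> carrier_vec n"
  shows "inv_mat A *\<^sub>v (A *\<^sub>v x) = x"
proof -
  from det_non_zero_imp_unit[OF A det, of "()"] mat_inverse(1)[OF A, of "()"]
  obtain C where C: "mat_inverse A = Some C" by (cases "mat_inverse A") auto
  from mat_inverse(2)[OF A C] have "C * A = 1\<^sub>m n" "C \<in> carrier_mat n n" by auto
  then show ?thesis using A x C by (simp add: inv_mat_def flip: assoc_mult_mat_vec)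
qed

lemma smult_one_mult_vec:
  fixes v :: "real vec"
  assumes "v \<in> carrier_vec n"
  shows "(a \<cdot>\<^sub>m 1\<^sub>m n) *\<^sub>v v = a \<cdot>\<^sub>v v"
  using assms by (intro eq_vecI) (auto simp: smult_scalar_prod_distrib[of _ n])

text \<open>Pairing a kernel vector \<open>v\<close> with its image gives |A v|^2 + \<alpha> |v|^2 =
  0, which forces \<open>v\<close> to vanish.\<close>

lemma det_gram_plus_pos:
  fixes A :: "real mat"
  assumes A: "A \<in> carrier_mat m n" and a: "\<alpha> > 0"
  shows "det (transpose_mat A * A + \<alpha> \<cdot>\<^sub>m 1\<^sub>m n) \<noteq> 0"
proof
  let ?G = "transpose_mat A * A + \<alpha> \<cdot>\<^sub>m 1\<^sub>m n"
  have AT: "transpose_mat A \<in> carrier_mat n m" using A by simp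
  have G: "?G \<in> carrier_mat n n" using A by auto
  assume "det ?G = 0"
  then obtain v where v: "v \<in> carrier_vec n" "v \<noteq> 0\<^sub>v n" and Gv: "?G *\<^sub>v v = 0\<^sub>v n"
    using det_0_iff_vec_prod_zero_field[OF G] by blast
  have Av: "A *\<^sub>v v \<in> carrier_vec m" using A v by simp
  have eq: "?G *\<^sub>v v = transpose_mat A *\<^sub>v (A *\<^sub>v v) + \<alpha> \<cdot>\<^sub>v v"
    using A AT v by (subst add_mult_distrib_mat_vec[of _ n n]) (auto simp: smult_one_mult_vec)
  then have "0 = (transpose_mat A *\<^sub>v (A *\<^sub>v v) + \<alpha> \<cdot>\<^sub>v v) \<bullet> v"
    unfolding eq[symmetric] Gv using v by simp
  also have "\<dots> = (A *\<^sub>v v) \<bullet> (A *\<^sub>v v) + \<alpha> * (v \<bullet> v)"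
    using v AT Av A by (subst add_scalar_prod_distrib[of _ n]) (auto simp: transpose_vec_mult_scalar[OF A v(1) Av])
  finally have "\<alpha> * (v \<bullet> v) \<le> 0" using scalar_prod_self_nonneg[of "A *\<^sub>v v"] by linarith
  then have "v \<bullet> v = 0" using a scalar_prod_self_nonneg[of v] by (simp add: mult_le_0_iff)
  then show False using scalar_prod_self_eq_0_iff[OF v(1)] v(2) by simp
qed

text \<open>The vectors \<open>u i\<close> are left singular vectors and \<open>lam i\<close> are
  squared singular values. Right singular vectors are not part of the data; A^T u_i takes their
  place, up to length.\<close>

locale left_singular_basis = orthonormal_basis n u for n u +
  fixes A :: "real mat" and lam :: "nat \<Rightarrow> real"
  assumes A: "A \<in> carrier_mat n n"
    and eigen: "i < n \<Longrightarrow> (A * transpose_mat A) *\<^sub>v u i = lam i \<cdot>\<^sub>v u i"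
begin

lemma AT: "transpose_mat A \<in> carrier_mat n n" and AAT: "A * transpose_mat A \<in> carrier_mat n n"
  using A by auto

lemma gram_basis_sum: "A *\<^sub>v (transpose_mat A *\<^sub>v basis_sum n u c) = basis_sum n u (\<lambda>i. c i * lam i)"
proof -
  have "A *\<^sub>v (transpose_mat A *\<^sub>v basis_sum n u c) = (A * transpose_mat A) *\<^sub>v basis_sum n u c"
    by (rule assoc_mult_mat_vec[symmetric, OF A AT]) simp
  also have "\<dots> = basis_sum n u (\<lambda>i. c i * lam i)"
    by (rule mult_mat_basis_sum_eigen[OF AAT]) (simp_all add: u_carrier eigen)
  finally show ?thesis .
qed

lemma transpose_basis_sum_index:
  "j < n \<Longrightarrow> (transpose_mat A *\<^sub>v basis_sum n u c) $ j = (\<Sum>i<n. c i * (transpose_mat A *\<^sub>v u i) $ j)"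
  by (rule mult_mat_basis_sum_index[OF AT]) (simp_all add: u_carrier)

text \<open>Move A^T to the other factor and use the eigenvalue equation of A A^T. Besides
  \<open>0 \<le> lam i\<close>, this shows that A^T annihilates \<open>u i\<close> when
  \<open>lam i = 0\<close>, the cancellation on which the case \<alpha> = 0 rests.\<close>

lemma transpose_mult_norm:
  "i < n \<Longrightarrow> (transpose_mat A *\<^sub>v u i) \<bullet> (transpose_mat A *\<^sub>v u i) = lam i"
proof -
  assume i: "i < n"
  have "(transpose_mat A *\<^sub>v u i) \<bullet> (transpose_mat A *\<^sub>v u i) = u i \<bullet> (A *\<^sub>v (transpose_mat A *\<^sub>v u i))"
    using A AT u_carrier[OF i] by (intro transpose_vec_mult_scalar) auto
  also have "A *\<^sub>v (transpose_mat A *\<^sub>v u i) = lam i \<cdot>\<^sub>v u i"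
    using eigen[OF i] A AT u_carrier[OF i] by (subst assoc_mult_mat_vec[symmetric, of _ n n _ n]) auto
  also have "u i \<bullet> \<dots> = lam i" using u_carrier[OF i] u_orthonormal[OF i i] by simp
  finally show ?thesis .
qed

lemma lam_nonneg: "i < n \<Longrightarrow> 0 \<le> lam i"
  using transpose_mult_norm scalar_prod_self_nonneg by metis

lemma transpose_mult_zero: "i < n \<Longrightarrow> lam i = 0 \<Longrightarrow> transpose_mat A *\<^sub>v u i = 0\<^sub>v n"
  using transpose_mult_norm[of i] scalar_prod_self_eq_0_iff[of "transpose_mat A *\<^sub>v u i" n] AT u_carrier[of i]
  by simp

text \<open>Push-through identity: (A^T A + \<alpha>) A^T b = A^T (A A^T + \<alpha>) b. The vector
  in brackets on the right acts diagonally in the basis \<open>u\<close>, and \<open>b\<close> is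
  chosen so that it returns \<open>y\<close>; inverting the regularized Gram matrix then gives the
  claim.\<close>

lemma tikhonov_pos_eq:
  assumes a: "\<alpha> > 0" and y: "y \<in> carrier_vec n"
  shows "tikhonov_pos A \<alpha> y = transpose_mat A *\<^sub>v basis_sum n u (\<lambda>i. (u i \<bullet> y) / (lam i + \<alpha>))"
proof -
  let ?c = "\<lambda>i. (u i \<bullet> y) / (lam i + \<alpha>)"
  let ?b = "basis_sum n u ?c"
  let ?G = "transpose_mat A * A + \<alpha> \<cdot>\<^sub>m 1\<^sub>m n"
  have G: "?G \<in> carrier_mat n n" using A by auto
  have b: "?b \<in> carrier_vec n" by simp
  have ATb: "transpose_mat A *\<^sub>v ?b \<in> carrier_vec n" using AT by simp
  have "?G *\<^sub>v (transpose_mat A *\<^sub>v ?b)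
      = transpose_mat A *\<^sub>v (A *\<^sub>v (transpose_mat A *\<^sub>v ?b)) + \<alpha> \<cdot>\<^sub>v (transpose_mat A *\<^sub>v ?b)"
    using A AT ATb by (subst add_mult_distrib_mat_vec[of _ n n]) (auto simp: smult_one_mult_vec)
  also have "\<dots> = transpose_mat A *\<^sub>v (basis_sum n u (\<lambda>i. ?c i * lam i) + \<alpha> \<cdot>\<^sub>v ?b)"
    unfolding gram_basis_sum
    by (subst mult_add_distrib_mat_vec[OF AT]) (auto simp: mult_mat_vec[OF AT b])
  also have "basis_sum n u (\<lambda>i. ?c i * lam i) + \<alpha> \<cdot>\<^sub>v ?b = basis_sum n u (\<lambda>i. u i \<bullet> y)"
  proof (rule eq_vecI)
    fix j assume "j < dim_vec (basis_sum n u (\<lambda>i. u i \<bullet> y))"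
    then have j: "j < n" by (simp add: basis_sum_def)
    have "?c i * lam i + \<alpha> * ?c i = u i \<bullet> y" if "i < n" for i
    proof -
      have "lam i + \<alpha> \<noteq> 0" using lam_nonneg[OF that] a by simp
      moreover have "?c i * lam i + \<alpha> * ?c i = ?c i * (lam i + \<alpha>)" by (metis distrib_left mult.commute)
      ultimately show ?thesis by simp
    qed
    then have "(\<Sum>i<n. (?c i * lam i + \<alpha> * ?c i) * u i $ j) = (\<Sum>i<n. (u i \<bullet> y) * u i $ j)"
      by (intro sum.cong) auto
    moreover have "(\<Sum>i<n. (?c i * lam i + \<alpha> * ?c i) * u i $ j)
        = (\<Sum>i<n. ?c i * lam i * u i $ j) + \<alpha> * (\<Sum>i<n. ?c i * u i $ j)"
      by (simp only: distrib_right sum.distrib sum_distrib_left mult.assoc)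
    ultimately show "(basis_sum n u (\<lambda>i. ?c i * lam i) + \<alpha> \<cdot>\<^sub>v ?b) $ j = basis_sum n u (\<lambda>i. u i \<bullet> y) $ j"
      using j by (simp add: basis_sum_def)
  qed (simp add: basis_sum_def)
  also have "\<dots> = y" by (rule expansion[OF y])
  finally have "?G *\<^sub>v (transpose_mat A *\<^sub>v ?b) = transpose_mat A *\<^sub>v y" .
  with inv_mat_mult_vec[OF G det_gram_plus_pos[OF A a] ATb] show ?thesis
    using A by (simp add: tikhonov_pos_def)
qed

text \<open>Since \<open>x / 0 = 0\<close>, the formula also covers \<open>\<alpha> = 0\<close>: there the terms with \<open>lam i = 0\<close>
  vanish, as in the pseudoinverse.\<close>

lemma tikhonov_eq:
  assumes a: "\<alpha> \<ge> 0" and y: "y \<in> carrier_vec n"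
  shows "tikhonov A \<alpha> y = transpose_mat A *\<^sub>v basis_sum n u (\<lambda>i. (u i \<bullet> y) / (lam i + \<alpha>))"
proof (cases "\<alpha> = 0")
  case True
  show ?thesis
  proof (rule eq_vecI)
    fix j assume "j < dim_vec (transpose_mat A *\<^sub>v basis_sum n u (\<lambda>i. (u i \<bullet> y) / (lam i + \<alpha>)))"
    then have j: "j < n" using A by simp
    let ?f = "\<lambda>a. \<Sum>i<n. (u i \<bullet> y) / (lam i + a) * (transpose_mat A *\<^sub>v u i) $ j"
    have lim: "(?f \<longlongrightarrow> ?f 0) (at_right 0)"
    proof (rule tendsto_sum)
      fix i assume "i \<in> {..<n}"
      then have i: "i < n" by simp
      show "((\<lambda>a. (u i \<bullet> y) / (lam i + a) * (transpose_mat A *\<^sub>v u i) $ j)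
          \<longlongrightarrow> (u i \<bullet> y) / (lam i + 0) * (transpose_mat A *\<^sub>v u i) $ j) (at_right 0)"
      \<comment> \<open>For \<open>lam i = 0\<close> the quotient may blow up as \<open>a\<close>
        tends to 0, but it is multiplied by an entry of A^T u_i, which is exactly 0. All other terms
        are continuous at 0.\<close>
      proof (cases "lam i = 0")
        case True
        then show ?thesis using transpose_mult_zero[OF i] j by simp
      next
        case False
        then show ?thesis by (intro tendsto_intros) auto
      qed
    qed
    have "eventually (\<lambda>a. tikhonov_pos A a y $ j = ?f a) (at_right 0)"
      unfolding eventually_at_right_field
      by (intro exI[of _ 1]) (auto simp: tikhonov_pos_eq[OF _ y] transpose_basis_sum_index[OF j])
    then have "((\<lambda>a. tikhonov_pos A a y $ j) \<longlongrightarrow> ?f 0) (at_right 0)"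
      using lim by (simp add: tendsto_cong)
    then have "Lim (at_right 0) (\<lambda>a. tikhonov_pos A a y $ j) = ?f 0"
      by (intro tendsto_Lim) simp_all
    then show "tikhonov A \<alpha> y $ j = (transpose_mat A *\<^sub>v basis_sum n u (\<lambda>i. (u i \<bullet> y) / (lam i + \<alpha>))) $ j"
      using True j A by (simp add: tikhonov_def transpose_basis_sum_index[OF j])
  qed (use True A in \<open>simp add: tikhonov_def\<close>)
next
  case False
  then show ?thesis using a tikhonov_pos_eq[OF _ y] by (simp add: tikhonov_def)
qed

text \<open>For \<open>lam i + \<alpha> \<noteq> 0\<close> the factor is - \<alpha> /
  (\<open>lam i\<close> + \<alpha>). The form with \<open>1 -\<close> is the one that stays correct
  for \<open>lam i = \<alpha> = 0\<close>: since \<open>0 / 0 = 0\<close> it gives -1, the limit as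
  \<alpha> decreases to 0, while the simplified quotient would give 0.\<close>

lemma residual_eq:
  assumes a: "\<alpha> \<ge> 0" and y: "y \<in> carrier_vec n"
  shows "A *\<^sub>v tikhonov A \<alpha> y - y = basis_sum n u (\<lambda>i. - (1 - lam i / (lam i + \<alpha>)) * (u i \<bullet> y))"
proof -
  have "A *\<^sub>v tikhonov A \<alpha> y = basis_sum n u (\<lambda>i. (u i \<bullet> y) / (lam i + \<alpha>) * lam i)"
    unfolding tikhonov_eq[OF a y] by (rule gram_basis_sum)
  then have "A *\<^sub>v tikhonov A \<alpha> y - y = basis_sum n u (\<lambda>i. (u i \<bullet> y) / (lam i + \<alpha>) * lam i) - basis_sum n u (\<lambda>i. u i \<bullet> y)"
    unfolding expansion[OF y] by simp
  also have "\<dots> = basis_sum n u (\<lambda>i. - (1 - lam i / (lam i + \<alpha>)) * (u i \<bullet> y))"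
    by (rule eq_vecI) (auto simp: basis_sum_def sum_subtractf[symmetric] algebra_simps intro!: sum.cong)
  finally show ?thesis .
qed

lemma DP_eq:
  assumes a: "\<alpha> \<ge> 0" and y: "y \<in> carrier_vec n"
  shows "DP \<sigma> A \<alpha> y = (\<Sum>i<n. (1 - lam i / (lam i + \<alpha>))\<^sup>2 * (u i \<bullet> y)\<^sup>2) - real n * \<sigma>\<^sup>2"
proof -
  have "(l2_norm (A *\<^sub>v tikhonov A \<alpha> y - y))\<^sup>2 = (\<Sum>i<n. (- (1 - lam i / (lam i + \<alpha>)) * (u i \<bullet> y))\<^sup>2)"
    unfolding l2_norm_def residual_eq[OF a y] basis_sum_norm by (simp only: real_sqrt_pow2 sum_nonneg zero_le_power2)
  also have "\<dots> = (\<Sum>i<n. (1 - lam i / (lam i + \<alpha>))\<^sup>2 * (u i \<bullet> y)\<^sup>2)"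
    by (simp only: power_mult_distrib power2_minus)
  finally show ?thesis using A by (simp add: DP_def)
qed

end

text \<open>The basis diagonalizes A A^T only, so the contraction property is first seen for A^T.
  With z = A x and v = A^T z one has |v|^2 \<le> |z|^2, while the scalar product of v and x equals
  |z|^2. Expanding 0 \<le> |x - v|^2 then yields |z|^2 \<le> |x|^2.\<close>

lemma (in left_singular_basis) mult_vec_norm_le:
  assumes lam: "\<And>i. i < n \<Longrightarrow> lam i \<le> 1" and x: "x \<in> carrier_vec n"
  shows "(A *\<^sub>v x) \<bullet> (A *\<^sub>v x) \<le> x \<bullet> x"
proof -
  define z where "z = A *\<^sub>v x"
  define v where "v = transpose_mat A *\<^sub>v z"
  have z: "z \<in> carrier_vec n" and v: "v \<in> carrier_vec n" using A x by (auto simp: z_def v_def)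
  let ?c = "\<lambda>i. u i \<bullet> z"
  have zc: "z = basis_sum n u ?c" by (rule expansion[OF z, symmetric])
  have "v \<bullet> v = z \<bullet> (A *\<^sub>v v)"
    using transpose_vec_mult_scalar[OF A v z] by (simp add: v_def)
  also have "A *\<^sub>v v = basis_sum n u (\<lambda>i. ?c i * lam i)"
    unfolding v_def by (subst zc) (rule gram_basis_sum)
  also have "z \<bullet> \<dots> = (\<Sum>i<n. ?c i * (?c i * lam i))"
    by (subst zc) (rule basis_sum_scalar_prod)
  also have "\<dots> \<le> (\<Sum>i<n. (?c i)\<^sup>2)"
    using lam by (intro sum_mono) (auto simp: power2_eq_square mult.assoc[symmetric] intro!: mult_left_le)
  also have "\<dots> = z \<bullet> z" by (rule parseval[OF z])
  finally have vz: "v \<bullet> v \<le> z \<bullet> z" .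
  have "v \<bullet> x = z \<bullet> z" using transpose_vec_mult_scalar[OF A x z] by (simp add: v_def z_def)
  moreover have "x \<bullet> v = v \<bullet> x" using comm_scalar_prod[OF x v] .
  moreover have "(x - v) \<bullet> (x - v) = x \<bullet> x - x \<bullet> v - (v \<bullet> x - v \<bullet> v)"
    using x v by (simp add: minus_scalar_prod_distrib[of _ n] scalar_prod_minus_distrib[of _ n])
  ultimately show ?thesis
    using scalar_prod_self_nonneg[of "x - v"] vz unfolding z_def by linarith
qed

text \<open>Singular values are defined through A^T A, but \<open>lam\<close> comes from A A^T. A
  nonzero eigenvalue transfers, with eigenvector A^T u_i, so \<open>lam i\<close> is a root of the
  product of the factors with roots \<open>(gam j)\<^sup>2\<close>.\<close>

lemma (in left_singular_basis) lam_le_1: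
  assumes sing: "has_singular_values A gam" and le: "\<And>j. j \<in> {1..n} \<Longrightarrow> gam j \<le> 1" and i: "i < n"
  shows "lam i \<le> 1"
proof (cases "lam i = 0")
  case False
  let ?v = "transpose_mat A *\<^sub>v u i"
  have v: "?v \<in> carrier_vec n" by (rule mult_mat_vec_carrier[OF AT u_carrier[OF i]])
  have TA: "transpose_mat A * A \<in> carrier_mat n n" using A by auto
  have "?v \<noteq> 0\<^sub>v n"
    using transpose_mult_norm[OF i] False scalar_prod_self_eq_0_iff[OF v] by auto
  moreover have "(transpose_mat A * A) *\<^sub>v ?v = lam i \<cdot>\<^sub>v ?v"
  proof -
    have "(transpose_mat A * A) *\<^sub>v ?v = transpose_mat A *\<^sub>v (A *\<^sub>v ?v)"
      by (rule assoc_mult_mat_vec[OF AT A v])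
    also have "A *\<^sub>v ?v = lam i \<cdot>\<^sub>v u i"
      unfolding eigen[OF i, symmetric] by (rule assoc_mult_mat_vec[OF A AT u_carrier[OF i], symmetric])
    also have "transpose_mat A *\<^sub>v \<dots> = lam i \<cdot>\<^sub>v ?v"
      by (rule mult_mat_vec[OF AT u_carrier[OF i]])
    finally show ?thesis .
  qed
  ultimately have "eigenvalue (transpose_mat A * A) (lam i)"
    using A v unfolding eigenvalue_def eigenvector_def by auto
  then have "poly (char_poly (transpose_mat A * A)) (lam i) = 0"
    using eigenvalue_root_char_poly[OF TA] by simp
  then have "(\<Prod>j\<in>{1..n}. lam i - (gam j)\<^sup>2) = 0"
    using sing A by (simp add: has_singular_values_def poly_prod)
  then obtain j where j: "j \<in> {1..n}" "lam i = (gam j)\<^sup>2" by auto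
  moreover have "0 \<le> gam j" using sing A j(1) by (auto simp: has_singular_values_def)
  ultimately show ?thesis using le[of j] by (simp add: power_le_one)
qed simp

lemma left_singular_basis_exists:
  assumes "A \<in> carrier_mat n n"
  obtains u lam where "left_singular_basis n u A lam"
    "\<And>i j. i \<le> j \<Longrightarrow> j < n \<Longrightarrow> lam i \<le> lam j"
proof -
  have "A * transpose_mat A \<in> carrier_mat n n" using assms by auto
  moreover have "transpose_mat (A * transpose_mat A) = A * transpose_mat A"
    using assms by (subst transpose_mult[of _ n n _ n]) auto
  ultimately obtain u lam where "\<And>i. i < n \<Longrightarrow> u i \<in> carrier_vec n"
    "\<And>i j. i < n \<Longrightarrow> j < n \<Longrightarrow> u i \<bullet> u j = (if i = j then 1 else 0)"
    "\<And>i. i < n \<Longrightarrow> (A * transpose_mat A) *\<^sub>v u i = lam i \<cdot>\<^sub>v u i"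
    "\<And>i j. i \<le> j \<Longrightarrow> j < n \<Longrightarrow> lam i \<le> (lam j :: real)"
    by (rule symmetric_mat_sorted_eigenbasis) blast
  then show ?thesis using assms by (intro that[of u lam]) (unfold_locales, auto)
qed

section \<open>Rotation invariance of the Gaussian distribution\<close>

text \<open>A product measure is determined by its values on boxes, and on a box the claim is
  translation invariance in each coordinate.\<close>

lemma nn_integral_PiM_lborel_shift:
  fixes c :: "'i \<Rightarrow> real"
  assumes I: "finite I" and f: "f \<in> borel_measurable (Pi\<^sub>M I (\<lambda>_. lborel))"
  shows "(\<integral>\<^sup>+x. f (\<lambda>i\<in>I. x i + c i) \<partial>(Pi\<^sub>M I (\<lambda>_. lborel))) = (\<integral>\<^sup>+x. f x \<partial>(Pi\<^sub>M I (\<lambda>_. lborel)))"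
proof -
  interpret product_sigma_finite "\<lambda>_::'i. lborel :: real measure" ..
  let ?L = "Pi\<^sub>M I (\<lambda>_. lborel :: real measure)"
  let ?s = "\<lambda>x. \<lambda>i\<in>I. x i + c i"
  have s: "?s \<in> measurable ?L ?L"
    by measurable
  have "distr ?L ?L ?s = ?L"
  proof (rule PiM_eqI[OF I])
    fix A :: "'i \<Rightarrow> real set" assume A: "\<And>i. i \<in> I \<Longrightarrow> A i \<in> sets lborel"
    have "emeasure (distr ?L ?L ?s) (Pi\<^sub>E I A) = emeasure ?L (?s -` Pi\<^sub>E I A \<inter> space ?L)"
      using A s I by (intro emeasure_distr) auto
    also have "?s -` Pi\<^sub>E I A \<inter> space ?L = (\<Pi>\<^sub>E i\<in>I. (\<lambda>t. c i + t) -` A i)"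
      by (auto simp: space_PiM PiE_iff add.commute)
    also have "emeasure ?L \<dots> = (\<Prod>i\<in>I. emeasure lborel ((\<lambda>t. c i + t) -` A i))"
    proof (rule emeasure_PiM[OF I])
      fix i assume "i \<in> I"
      then have "(\<lambda>t. c i + t) -` A i \<inter> space lborel \<in> sets lborel"
        using A by (intro measurable_sets[of _ _ borel]) auto
      then show "(\<lambda>t. c i + t) -` A i \<in> sets lborel" by simp
    qed
    also have "\<dots> = (\<Prod>i\<in>I. emeasure lborel (A i))"
    proof (rule prod.cong[OF refl])
      fix i assume i: "i \<in> I"
      have "emeasure lborel (A i) = emeasure (distr lborel borel ((+) (c i))) (A i)"
        by (simp add: lborel_distr_plus)
      also have "\<dots> = emeasure lborel ((\<lambda>t. c i + t) -` A i)"
        using A[OF i] by (subst emeasure_distr) auto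
      finally show "emeasure lborel ((\<lambda>t. c i + t) -` A i) = emeasure lborel (A i)" ..
    qed
    finally show "emeasure (distr ?L ?L ?s) (Pi\<^sub>E I A) = (\<Prod>i\<in>I. emeasure lborel (A i))" .
  qed simp
  then have "(\<integral>\<^sup>+x. f x \<partial>?L) = (\<integral>\<^sup>+x. f x \<partial>(distr ?L ?L ?s))" by simp
  also have "\<dots> = (\<integral>\<^sup>+x. f (?s x) \<partial>?L)"
    using s f by (intro nn_integral_distr) auto
  finally show ?thesis ..
qed

section \<open>Orthogonal maps on coordinate tuples and the isotropic Gaussian density\<close>

definition lin_map :: "'i set \<Rightarrow> ('i \<Rightarrow> 'i \<Rightarrow> real) \<Rightarrow> ('i \<Rightarrow> real) \<Rightarrow> 'i \<Rightarrow> real" where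
  "lin_map I R x = (\<lambda>i\<in>I. \<Sum>j\<in>I. R i j * x j)"

lemma measurable_lin_map [measurable]:
  "lin_map I R \<in> measurable (Pi\<^sub>M I (\<lambda>_. lborel)) (Pi\<^sub>M I (\<lambda>_. lborel))"
  unfolding lin_map_def by measurable

lemma measurable_lin_map_component [measurable (raw)]:
  assumes g: "g \<in> measurable N (Pi\<^sub>M I (\<lambda>_. lborel))" and i: "i \<in> I"
  shows "(\<lambda>w. lin_map I R (g w) i) \<in> borel_measurable N"
  using measurable_compose[OF measurable_compose[OF g measurable_lin_map] measurable_component_singleton[OF i]]
  by simp

lemma lin_map_sum_squares:
  assumes I: "finite I"
    and R: "\<And>j k. j \<in> I \<Longrightarrow> k \<in> I \<Longrightarrow> (\<Sum>i\<in>I. R i j * R i k) = (if j = k then 1 else 0)"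
  shows "(\<Sum>i\<in>I. (lin_map I R x i)\<^sup>2) = (\<Sum>i\<in>I. (x i)\<^sup>2)"
proof -
  have "(\<Sum>i\<in>I. (lin_map I R x i)\<^sup>2) = (\<Sum>i\<in>I. \<Sum>j\<in>I. \<Sum>k\<in>I. x j * x k * (R i j * R i k))"
    unfolding lin_map_def power2_eq_square
    by (intro sum.cong refl) (simp add: sum_product algebra_simps)
  also have "\<dots> = (\<Sum>j\<in>I. \<Sum>k\<in>I. \<Sum>i\<in>I. x j * x k * (R i j * R i k))"
    by (rule trans[OF sum.swap]) (rule sum.cong[OF refl], rule sum.swap)
  also have "\<dots> = (\<Sum>j\<in>I. \<Sum>k\<in>I. x j * x k * (if j = k then 1 else 0))"
    by (intro sum.cong refl) (simp add: sum_distrib_left[symmetric] R)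
  also have "\<dots> = (\<Sum>j\<in>I. (x j)\<^sup>2)"
    using I by (intro sum.cong refl) (simp add: power2_eq_square if_distrib cong: if_cong)
  finally show ?thesis .
qed

text \<open>The inner sum is R^T c, and R R^T = 1: a translation by \<open>c\<close> after the map
  can be realized by a translation before it, where translation invariance of the measure
  applies.\<close>

lemma lin_map_shift:
  assumes I: "finite I"
    and R: "\<And>i k. i \<in> I \<Longrightarrow> k \<in> I \<Longrightarrow> (\<Sum>j\<in>I. R i j * R k j) = (if i = k then 1 else 0)"
  shows "lin_map I R (\<lambda>j\<in>I. x j + (\<Sum>k\<in>I. R k j * c k)) = (\<lambda>i\<in>I. lin_map I R x i + c i)"
proof
  fix i
  show "lin_map I R (\<lambda>j\<in>I. x j + (\<Sum>k\<in>I. R k j * c k)) i = (\<lambda>i\<in>I. lin_map I R x i + c i) i"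
  proof (cases "i \<in> I")
    case True
    have "(\<Sum>j\<in>I. R i j * (\<Sum>k\<in>I. R k j * c k)) = (\<Sum>k\<in>I. c k * (\<Sum>j\<in>I. R i j * R k j))"
      unfolding sum_distrib_left by (subst sum.swap) (simp add: algebra_simps)
    also have "\<dots> = (\<Sum>k\<in>I. c k * (if i = k then 1 else 0))"
      using True by (intro sum.cong refl) (simp add: R)
    also have "\<dots> = c i" using True I by (simp add: if_distrib cong: if_cong)
    finally show ?thesis
      using True by (simp add: lin_map_def algebra_simps sum.distrib)
  qed (simp add: lin_map_def)
qed

definition gauss_density :: "'i set \<Rightarrow> real \<Rightarrow> ('i \<Rightarrow> real) \<Rightarrow> ennreal" where
  "gauss_density I s x = (\<Prod>i\<in>I. ennreal (normal_density 0 s (x i)))"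

lemma measurable_gauss_density [measurable]:
  "gauss_density I s \<in> borel_measurable (Pi\<^sub>M I (\<lambda>_. lborel))"
  unfolding gauss_density_def by measurable

lemma gauss_density_alt:
  assumes "finite I" "s > 0"
  shows "gauss_density I s x
    = ennreal ((1 / sqrt (2 * pi * s\<^sup>2)) ^ card I * exp (- (\<Sum>i\<in>I. (x i)\<^sup>2) / (2 * s\<^sup>2)))"
proof -
  have "gauss_density I s x = ennreal (\<Prod>i\<in>I. normal_density 0 s (x i))"
    unfolding gauss_density_def by (subst prod_ennreal) auto
  also have "(\<Prod>i\<in>I. normal_density 0 s (x i))
      = (1 / sqrt (2 * pi * s\<^sup>2)) ^ card I * exp (\<Sum>i\<in>I. - (x i)\<^sup>2 / (2 * s\<^sup>2))"
    using assms(1) by (simp add: normal_density_def prod_dividef exp_sum power_divide)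
  also have "(\<Sum>i\<in>I. - (x i)\<^sup>2 / (2 * s\<^sup>2)) = - (\<Sum>i\<in>I. (x i)\<^sup>2) / (2 * s\<^sup>2)"
    by (simp add: sum_divide_distrib sum_negf)
  finally show ?thesis .
qed

lemma nn_integral_gauss_density:
  assumes "finite I" "s > 0"
  shows "(\<integral>\<^sup>+x. gauss_density I s x \<partial>(Pi\<^sub>M I (\<lambda>_. lborel))) = 1"
proof -
  interpret product_sigma_finite "\<lambda>_::'a. lborel :: real measure" ..
  have "(\<integral>\<^sup>+t. ennreal (normal_density 0 s t) \<partial>lborel) = 1"
    using assms by (subst nn_integral_eq_integral) (auto simp: integrable_normal_density integral_normal_density)
  then show ?thesis
    unfolding gauss_density_def using assms
    by (subst product_nn_integral_prod) auto
qed

lemma gauss_density_lin_map: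
  assumes "finite I" "s > 0"
    and R: "\<And>j k. j \<in> I \<Longrightarrow> k \<in> I \<Longrightarrow> (\<Sum>i\<in>I. R i j * R i k) = (if j = k then 1 else 0)"
  shows "gauss_density I s (lin_map I R x) = gauss_density I s x"
  using assms lin_map_sum_squares[OF assms(1) R] by (simp add: gauss_density_alt)

text \<open>Fubini argument: in \<open>\<integral>\<integral> f (R x) g (y) dy dx\<close> with a rotation invariant probability density
  \<open>g\<close>, shift \<open>y\<close> by \<open>R x\<close>, and then \<open>x\<close> by \<open>- R\<^sup>T y\<close>. The reflection is removed afterwards by comparing
  with the case where \<open>R\<close> is the identity.\<close>

lemma nn_integral_PiM_lborel_orthogonal_reflect:
  assumes I: "finite I"
    and R1: "\<And>i k. i \<in> I \<Longrightarrow> k \<in> I \<Longrightarrow> (\<Sum>j\<in>I. R i j * R k j) = (if i = k then 1 else 0)"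
    and R2: "\<And>j k. j \<in> I \<Longrightarrow> k \<in> I \<Longrightarrow> (\<Sum>i\<in>I. R i j * R i k) = (if j = k then 1 else 0)"
    and [measurable]: "f \<in> borel_measurable (Pi\<^sub>M I (\<lambda>_. lborel))"
  shows "(\<integral>\<^sup>+x. f (lin_map I R x) \<partial>(Pi\<^sub>M I (\<lambda>_. lborel))) = (\<integral>\<^sup>+x. f (\<lambda>i\<in>I. - x i) \<partial>(Pi\<^sub>M I (\<lambda>_. lborel)))"
proof -
  interpret product_sigma_finite "\<lambda>_::'a. lborel :: real measure" ..
  let ?L = "Pi\<^sub>M I (\<lambda>_. lborel :: real measure)"
  interpret L: sigma_finite_measure ?L by (rule sigma_finite[OF I])
  interpret LL: pair_sigma_finite ?L ?L ..
  let ?T = "lin_map I R"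
  let ?g = "gauss_density I 1"
  \<comment> \<open>Insert the factor 1 as the integral of the Gaussian density in a new variable
    \<open>y\<close>.\<close>
  have "(\<integral>\<^sup>+x. f (?T x) \<partial>?L) = (\<integral>\<^sup>+x. \<integral>\<^sup>+y. f (?T x) * ?g y \<partial>?L \<partial>?L)"
    by (subst nn_integral_cmult) (simp_all add: nn_integral_gauss_density[OF I])
  also have "\<dots> = (\<integral>\<^sup>+x. \<integral>\<^sup>+y. f (?T x) * ?g (\<lambda>i\<in>I. y i + ?T x i) \<partial>?L \<partial>?L)"
  proof (rule nn_integral_cong)
    fix x
    show "(\<integral>\<^sup>+y. f (?T x) * ?g y \<partial>?L) = (\<integral>\<^sup>+y. f (?T x) * ?g (\<lambda>i\<in>I. y i + ?T x i) \<partial>?L)"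
      by (rule nn_integral_PiM_lborel_shift[OF I, symmetric]) measurable
  qed
  also have "\<dots> = (\<integral>\<^sup>+y. \<integral>\<^sup>+x. f (?T x) * ?g (\<lambda>i\<in>I. y i + ?T x i) \<partial>?L \<partial>?L)"
    by (rule LL.Fubini'[symmetric]) measurable
  also have "\<dots> = (\<integral>\<^sup>+y. \<integral>\<^sup>+x. f (\<lambda>i\<in>I. ?T x i + - y i) * ?g (?T x) \<partial>?L \<partial>?L)"
  proof (rule nn_integral_cong)
    fix y assume y: "y \<in> space ?L"
    let ?d = "\<lambda>j. \<Sum>k\<in>I. R k j * - y k"
    have "(\<integral>\<^sup>+x. f (?T x) * ?g (\<lambda>i\<in>I. y i + ?T x i) \<partial>?L)
        = (\<integral>\<^sup>+x. f (?T (\<lambda>j\<in>I. x j + ?d j)) * ?g (\<lambda>i\<in>I. y i + ?T (\<lambda>j\<in>I. x j + ?d j) i) \<partial>?L)"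
      using y by (intro nn_integral_PiM_lborel_shift[OF I, symmetric]) measurable
    also have "\<dots> = (\<integral>\<^sup>+x. f (\<lambda>i\<in>I. ?T x i + - y i) * ?g (?T x) \<partial>?L)"
    proof (rule nn_integral_cong)
      fix x
      have shift: "?T (\<lambda>j\<in>I. x j + ?d j) = (\<lambda>i\<in>I. ?T x i + - y i)"
        by (rule lin_map_shift[OF I]) (rule R1)
      have eq: "(\<lambda>i\<in>I. y i + (\<lambda>i\<in>I. ?T x i + - y i) i) = ?T x"
        by (auto simp: lin_map_def)
      show "f (?T (\<lambda>j\<in>I. x j + ?d j)) * ?g (\<lambda>i\<in>I. y i + ?T (\<lambda>j\<in>I. x j + ?d j) i)
          = f (\<lambda>i\<in>I. ?T x i + - y i) * ?g (?T x)"
        unfolding shift eq ..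
    qed
    finally show "(\<integral>\<^sup>+x. f (?T x) * ?g (\<lambda>i\<in>I. y i + ?T x i) \<partial>?L)
        = (\<integral>\<^sup>+x. f (\<lambda>i\<in>I. ?T x i + - y i) * ?g (?T x) \<partial>?L)" .
  qed
  also have "\<dots> = (\<integral>\<^sup>+x. \<integral>\<^sup>+y. f (\<lambda>i\<in>I. ?T x i + - y i) * ?g (?T x) \<partial>?L \<partial>?L)"
    by (rule LL.Fubini'[symmetric]) measurable
  also have "\<dots> = (\<integral>\<^sup>+x. (\<integral>\<^sup>+y. f (\<lambda>i\<in>I. - y i) \<partial>?L) * ?g x \<partial>?L)"
  proof (rule nn_integral_cong)
    fix x assume x: "x \<in> space ?L"
    have "(\<integral>\<^sup>+y. f (\<lambda>i\<in>I. ?T x i + - y i) * ?g (?T x) \<partial>?L) = (\<integral>\<^sup>+y. f (\<lambda>i\<in>I. ?T x i + - y i) \<partial>?L) * ?g x"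
      using x by (subst nn_integral_multc) (measurable, simp add: gauss_density_lin_map[OF I _ R2])
    \<comment> \<open>A third translation, again of \<open>y\<close> by the image of
      \<open>x\<close>, frees the inner integral from \<open>x\<close>. The remaining integral of
      the density over \<open>x\<close> is 1.\<close>
    also have "(\<integral>\<^sup>+y. f (\<lambda>i\<in>I. ?T x i + - y i) \<partial>?L)
        = (\<integral>\<^sup>+y. f (\<lambda>i\<in>I. ?T x i + - (\<lambda>i\<in>I. y i + ?T x i) i) \<partial>?L)"
      using x by (intro nn_integral_PiM_lborel_shift[OF I, symmetric]) measurable
    also have "\<dots> = (\<integral>\<^sup>+y. f (\<lambda>i\<in>I. - y i) \<partial>?L)"
      by (intro nn_integral_cong arg_cong[where f=f]) auto
    finally show "(\<integral>\<^sup>+y. f (\<lambda>i\<in>I. ?T x i + - y i) * ?g (?T x) \<partial>?L) = (\<integral>\<^sup>+y. f (\<lambda>i\<in>I. - y i) \<partial>?L) * ?g x" .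
  qed
  also have "\<dots> = (\<integral>\<^sup>+y. f (\<lambda>i\<in>I. - y i) \<partial>?L)"
    by (subst nn_integral_cmult) (simp_all add: nn_integral_gauss_density[OF I])
  finally show ?thesis .
qed

lemma nn_integral_PiM_lborel_orthogonal:
  assumes I: "finite I"
    and R1: "\<And>i k. i \<in> I \<Longrightarrow> k \<in> I \<Longrightarrow> (\<Sum>j\<in>I. R i j * R k j) = (if i = k then 1 else 0)"
    and R2: "\<And>j k. j \<in> I \<Longrightarrow> k \<in> I \<Longrightarrow> (\<Sum>i\<in>I. R i j * R i k) = (if j = k then 1 else 0)"
    and f: "f \<in> borel_measurable (Pi\<^sub>M I (\<lambda>_. lborel))"
  shows "(\<integral>\<^sup>+x. f (lin_map I R x) \<partial>(Pi\<^sub>M I (\<lambda>_. lborel))) = (\<integral>\<^sup>+x. f x \<partial>(Pi\<^sub>M I (\<lambda>_. lborel)))"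
proof -
  let ?Id = "\<lambda>i j. if i = j then 1 else 0 :: real"
  have Id: "lin_map I ?Id x = x" if "x \<in> space (Pi\<^sub>M I (\<lambda>_. lborel))" for x
    using that I by (auto simp: lin_map_def space_PiM PiE_iff extensional_def
      if_distrib[of "\<lambda>x. x * _"] cong: if_cong)
  have "(\<integral>\<^sup>+x. f (lin_map I ?Id x) \<partial>(Pi\<^sub>M I (\<lambda>_. lborel))) = (\<integral>\<^sup>+x. f (\<lambda>i\<in>I. - x i) \<partial>(Pi\<^sub>M I (\<lambda>_. lborel)))"
    using I by (intro nn_integral_PiM_lborel_orthogonal_reflect[OF I _ _ f])
      (auto simp: if_distrib[of "\<lambda>x. x * _"] if_distrib[of "\<lambda>x. _ * x"] cong: if_cong)
  moreover have "(\<integral>\<^sup>+x. f (lin_map I ?Id x) \<partial>(Pi\<^sub>M I (\<lambda>_. lborel))) = (\<integral>\<^sup>+x. f x \<partial>(Pi\<^sub>M I (\<lambda>_. lborel)))"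
    by (intro nn_integral_cong arg_cong[where f=f] Id)
  moreover have "(\<integral>\<^sup>+x. f (lin_map I R x) \<partial>(Pi\<^sub>M I (\<lambda>_. lborel))) = (\<integral>\<^sup>+x. f (\<lambda>i\<in>I. - x i) \<partial>(Pi\<^sub>M I (\<lambda>_. lborel)))"
    by (rule nn_integral_PiM_lborel_orthogonal_reflect[OF I _ _ f]) (simp_all add: R1 R2)
  ultimately show ?thesis by simp
qed

text \<open>The density sees only the sum of squares, so \<open>?g x\<close> may be replaced by
  \<open>?g (?T x)\<close>. The whole integrand is then a function of the image point, and
  invariance of Lebesgue measure applies.\<close>

lemma distr_gauss_density_orthogonal:
  assumes I: "finite I" and s: "s > 0"
    and R1: "\<And>i k. i \<in> I \<Longrightarrow> k \<in> I \<Longrightarrow> (\<Sum>j\<in>I. R i j * R k j) = (if i = k then 1 else 0)"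
    and R2: "\<And>j k. j \<in> I \<Longrightarrow> k \<in> I \<Longrightarrow> (\<Sum>i\<in>I. R i j * R i k) = (if j = k then 1 else 0)"
  shows "distr (density (Pi\<^sub>M I (\<lambda>_. lborel)) (gauss_density I s)) (Pi\<^sub>M I (\<lambda>_. lborel)) (lin_map I R)
    = density (Pi\<^sub>M I (\<lambda>_. lborel)) (gauss_density I s)" (is "distr (density ?L ?g) ?L ?T = _")
proof (rule measure_eqI)
  fix B assume "B \<in> sets (distr (density ?L ?g) ?L ?T)"
  then have B [measurable]: "B \<in> sets ?L" by simp
  have "emeasure (distr (density ?L ?g) ?L ?T) B = (\<integral>\<^sup>+x. indicator B x \<partial>(distr (density ?L ?g) ?L ?T))"
    using B by (subst nn_integral_indicator) auto
  also have "\<dots> = (\<integral>\<^sup>+x. indicator B (?T x) \<partial>(density ?L ?g))"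
    by (subst nn_integral_distr) measurable
  also have "\<dots> = (\<integral>\<^sup>+x. ?g x * indicator B (?T x) \<partial>?L)"
    by (subst nn_integral_density) measurable
  also have "\<dots> = (\<integral>\<^sup>+x. ?g (?T x) * indicator B (?T x) \<partial>?L)"
    by (simp add: gauss_density_lin_map[OF I s R2])
  also have "\<dots> = (\<integral>\<^sup>+x. ?g x * indicator B x \<partial>?L)"
    by (rule nn_integral_PiM_lborel_orthogonal[OF I R1 R2, where f="\<lambda>x. ?g x * indicator B x"]) measurable
  also have "\<dots> = emeasure (density ?L ?g) B"
    by (simp add: emeasure_density)
  finally show "emeasure (distr (density ?L ?g) ?L ?T) B = emeasure (density ?L ?g) B" .
qed simp

text \<open>On boxes the integral of a product density factorizes. This is the step from a joint
  density to independent coordinates.\<close>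

lemma density_gauss_eq_PiM:
  assumes I: "finite I" and s: "s > 0"
  shows "density (Pi\<^sub>M I (\<lambda>_. lborel)) (gauss_density I s)
    = Pi\<^sub>M I (\<lambda>_. density lborel (\<lambda>t. ennreal (normal_density 0 s t)))" (is "density ?L ?g = Pi\<^sub>M I (\<lambda>_. ?N)")
proof -
  interpret L: product_sigma_finite "\<lambda>_::'a. lborel :: real measure" ..
  interpret N: prob_space ?N by (rule prob_space_normal_density[OF s])
  interpret product_prob_space "\<lambda>_. ?N" I by unfold_locales
  have sets: "sets (density ?L ?g) = sets (Pi\<^sub>M I (\<lambda>_. ?N))"
    by (simp cong: sets_PiM_cong)
  show ?thesis
  proof (rule PiM_eqI[OF I sets])
    fix A :: "'a \<Rightarrow> real set" assume A: "\<And>i. i \<in> I \<Longrightarrow> A i \<in> sets ?N"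
    then have PA [measurable]: "Pi\<^sub>E I A \<in> sets ?L" using I by (intro sets_PiM_I_finite) auto
    have "emeasure (density ?L ?g) (Pi\<^sub>E I A) = (\<integral>\<^sup>+x. ?g x * indicator (Pi\<^sub>E I A) x \<partial>?L)"
      by (simp add: emeasure_density)
    also have "\<dots> = (\<integral>\<^sup>+x. (\<Prod>i\<in>I. ennreal (normal_density 0 s (x i)) * indicator (A i) (x i)) \<partial>?L)"
    proof (rule nn_integral_cong)
      fix x assume "x \<in> space ?L"
      then have "indicator (Pi\<^sub>E I A) x = (\<Prod>i\<in>I. indicator (A i) (x i) :: ennreal)"
        using I by (auto simp: indicator_def space_PiM PiE_iff prod_eq_1_iff prod_zero_iff)
      then show "?g x * indicator (Pi\<^sub>E I A) x = (\<Prod>i\<in>I. ennreal (normal_density 0 s (x i)) * indicator (A i) (x i))"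
        by (simp add: gauss_density_def prod.distrib)
    qed
    also have "\<dots> = (\<Prod>i\<in>I. \<integral>\<^sup>+t. ennreal (normal_density 0 s t) * indicator (A i) t \<partial>lborel)"
      using A by (intro L.product_nn_integral_prod[OF I]) auto
    also have "\<dots> = (\<Prod>i\<in>I. emeasure ?N (A i))"
      using A by (intro prod.cong refl) (auto simp: emeasure_density)
    finally show "emeasure (density ?L ?g) (Pi\<^sub>E I A) = (\<Prod>i\<in>I. emeasure ?N (A i))" .
  qed
qed

text \<open>The absolute value appears because only \<sigma>^2 > 0 is known, while the facts on
  \<open>gauss_density\<close> ask for a positive standard deviation.\<close>

lemma multivariate_normal_density_scalar:
  assumes "\<sigma>\<^sup>2 > 0"
  shows "ennreal (multivariate_normal_density (0\<^sub>v m) (\<sigma>\<^sup>2 \<cdot>\<^sub>m 1\<^sub>m m) (vec m z)) = gauss_density {..<m} \<bar>\<sigma>\<bar> z"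
proof -
  let ?z = "vec m z"
  have z: "?z \<in> carrier_vec m" by simp
  let ?S = "\<sigma>\<^sup>2 \<cdot>\<^sub>m 1\<^sub>m m :: real mat"
  have S: "?S \<in> carrier_mat m m" by simp
  have det: "det ?S = (\<sigma>\<^sup>2) ^ m" by simp
  have "?S *\<^sub>v ((1 / \<sigma>\<^sup>2) \<cdot>\<^sub>v ?z) = ?z"
    using assms by (subst smult_one_mult_vec[of _ m]) (auto simp: smult_smult_assoc)
  then have inv: "inv_mat ?S *\<^sub>v ?z = (1 / \<sigma>\<^sup>2) \<cdot>\<^sub>v ?z"
    using inv_mat_mult_vec[OF S, of "(1 / \<sigma>\<^sup>2) \<cdot>\<^sub>v ?z"] assms by simp
  have zz: "?z \<bullet> ?z = (\<Sum>i<m. (z i)\<^sup>2)"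
    by (simp add: scalar_prod_def atLeast0LessThan power2_eq_square)
  have "?z - 0\<^sub>v m = ?z" by (rule eq_vecI) auto
  then have "multivariate_normal_density (0\<^sub>v m) ?S ?z
      = exp (- (?z \<bullet> ((1 / \<sigma>\<^sup>2) \<cdot>\<^sub>v ?z)) / 2) / sqrt ((2 * pi) ^ m * (\<sigma>\<^sup>2) ^ m)"
    by (simp add: multivariate_normal_density_def inv)
  also have "?z \<bullet> ((1 / \<sigma>\<^sup>2) \<cdot>\<^sub>v ?z) = (\<Sum>i<m. (z i)\<^sup>2) / \<sigma>\<^sup>2"
    using scalar_prod_smult_distrib[OF z z] zz by simp
  also have "sqrt ((2 * pi) ^ m * (\<sigma>\<^sup>2) ^ m) = sqrt (2 * pi * \<sigma>\<^sup>2) ^ m"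
    by (simp only: real_sqrt_power flip: power_mult_distrib)
  finally show ?thesis
    using assms by (subst gauss_density_alt) (auto simp: power_divide mult.commute)
qed

text \<open>The rotated vector has the same product law as the original one. Its marginals are
  therefore the factors, and the joint law equals the product of the marginals, which is
  independence.\<close>

lemma (in prob_space) rotated_gauss:
  assumes I: "finite I" "I \<noteq> {}" and s: "s > 0"
    and R1: "\<And>i k. i \<in> I \<Longrightarrow> k \<in> I \<Longrightarrow> (\<Sum>j\<in>I. R i j * R k j) = (if i = k then 1 else 0)"
    and R2: "\<And>j k. j \<in> I \<Longrightarrow> k \<in> I \<Longrightarrow> (\<Sum>i\<in>I. R i j * R i k) = (if j = k then 1 else 0)"
    and X: "distributed M (Pi\<^sub>M I (\<lambda>_. lborel)) X (gauss_density I s)"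
  shows "indep_vars (\<lambda>_. borel) (\<lambda>i w. lin_map I R (X w) i) I"
    and "i \<in> I \<Longrightarrow> distributed M lborel (\<lambda>w. lin_map I R (X w) i) (\<lambda>t. ennreal (normal_density 0 s t))"
proof -
  let ?L = "Pi\<^sub>M I (\<lambda>_. lborel :: real measure)"
  let ?N = "density lborel (\<lambda>t. ennreal (normal_density 0 s t))"
  have [measurable]: "X \<in> measurable M ?L" and distrX: "distr M ?L X = density ?L (gauss_density I s)"
    using X by (auto simp: distributed_def)
  have dY: "distr M ?L (\<lambda>w. lin_map I R (X w)) = Pi\<^sub>M I (\<lambda>_. ?N)"
  proof -
    have "distr M ?L (\<lambda>w. lin_map I R (X w)) = distr (distr M ?L X) ?L (lin_map I R)"
      by (subst distr_distr) (auto simp: comp_def)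
    also have "\<dots> = density ?L (gauss_density I s)"
      unfolding distrX by (rule distr_gauss_density_orthogonal[OF I(1) s]) (simp_all add: R1 R2)
    finally show ?thesis unfolding density_gauss_eq_PiM[OF I(1) s] .
  qed
  have marg: "distr M lborel (\<lambda>w. lin_map I R (X w) i) = ?N" if i: "i \<in> I" for i
  proof -
    have "distr M lborel (\<lambda>w. lin_map I R (X w) i)
        = distr (distr M ?L (\<lambda>w. lin_map I R (X w))) lborel (\<lambda>z. z i)"
      using i by (subst distr_distr) (auto simp: comp_def)
    also have "\<dots> = distr (Pi\<^sub>M I (\<lambda>_. ?N)) ?N (\<lambda>z. z i)"
      unfolding dY by (rule distr_cong) auto
    also have "\<dots> = ?N"
      using i s by (intro distr_PiM_component prob_space_normal_density)
    finally show ?thesis .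
  qed
  show "distributed M lborel (\<lambda>w. lin_map I R (X w) i) (\<lambda>t. ennreal (normal_density 0 s t))" if "i \<in> I"
    using marg[OF that] that by (auto simp: distributed_def)
  \<comment> \<open>Same marginal, restated over \<open>borel\<close>, the target space used in the
    independence claim; \<open>lborel\<close> has the same measurable sets.\<close>
  have marg': "distr M borel (\<lambda>w. lin_map I R (X w) i) = ?N" if i: "i \<in> I" for i
    using marg[OF i] by (metis distr_cong sets_lborel)
  show "indep_vars (\<lambda>_. borel) (\<lambda>i w. lin_map I R (X w) i) I"
  proof (subst indep_vars_iff_distr_eq_PiM'[OF I(2)])
    have "(\<lambda>w. \<lambda>i\<in>I. lin_map I R (X w) i) = (\<lambda>w. lin_map I R (X w))"
      by (intro ext) (auto simp: lin_map_def)
    moreover have "distr M (Pi\<^sub>M I (\<lambda>_. borel)) (\<lambda>w. lin_map I R (X w)) = distr M ?L (\<lambda>w. lin_map I R (X w))"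
      by (intro distr_cong sets_PiM_cong) auto
    moreover have "Pi\<^sub>M I (\<lambda>i. distr M borel (\<lambda>w. lin_map I R (X w) i)) = Pi\<^sub>M I (\<lambda>_. ?N)"
      by (intro PiM_cong refl marg')
    ultimately show "distr M (Pi\<^sub>M I (\<lambda>_. borel)) (\<lambda>w. \<lambda>i\<in>I. lin_map I R (X w) i)
        = Pi\<^sub>M I (\<lambda>i. distr M borel (\<lambda>w. lin_map I R (X w) i))"
      using dY by simp
  qed measurable
qed

text \<open>\<open>Z\<close> is the centred square of \<open>X + c\<close>, whose mean is
  \<open>s\<^sup>2 + c\<^sup>2\<close>. The moments 0, \<open>s\<^sup>2\<close>, 0,
  \<open>3 * s ^ 4\<close> of orders one to four give the variance; \<open>c\<close> will be a
  coordinate of the noiseless data.\<close>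

lemma (in prob_space) normal_square_deviation:
  fixes c s :: real
  assumes s: "s > 0" and X: "distributed M lborel X (\<lambda>t. ennreal (normal_density 0 s t))"
  defines "Z \<equiv> \<lambda>w. (X w)\<^sup>2 - s\<^sup>2 + 2 * c * X w"
  shows "integrable M Z" "expectation Z = 0"
    "integrable M (\<lambda>w. (Z w)\<^sup>2)" "expectation (\<lambda>w. (Z w)\<^sup>2) = 2 * s ^ 4 + 4 * c\<^sup>2 * s\<^sup>2"
proof -
  have mom: "has_bochner_integral M (\<lambda>w. X w ^ k) q"
    if "has_bochner_integral lborel (\<lambda>t. normal_density 0 s t * (t - 0) ^ k) q" for k q
    using that distributed_integral[OF X, of "\<lambda>t. t ^ k"] distributed_integrable[OF X, of "\<lambda>t. t ^ k"]
    by (auto simp: has_bochner_integral_iff)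
  have m1: "has_bochner_integral M (\<lambda>w. X w ^ 1) 0"
    using mom[OF normal_moment_odd[OF s, of 0 0]] by simp
  have m3: "has_bochner_integral M (\<lambda>w. X w ^ 3) 0"
    using mom[OF normal_moment_odd[OF s, of 0 1]] by (simp add: eval_nat_numeral)
  have m2: "has_bochner_integral M (\<lambda>w. X w ^ 2) (s\<^sup>2)"
    using mom[OF normal_moment_even[OF s, of 0 1]] by (simp add: fact_numeral)
  have m4: "has_bochner_integral M (\<lambda>w. X w ^ 4) (3 * s ^ 4)"
    using mom[OF normal_moment_even[OF s, of 0 2]] s
    by (simp add: fact_numeral power_divide)
  have m0: "has_bochner_integral M (\<lambda>w. a) a" for a :: real
    by (simp add: has_bochner_integral_iff prob_space)
  have "has_bochner_integral M (\<lambda>w. X w ^ 2 - s\<^sup>2 + 2 * c * X w ^ 1) (s\<^sup>2 - s\<^sup>2 + 2 * c * 0)"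
    by (intro has_bochner_integral_add has_bochner_integral_diff m1 m2 m0 has_bochner_integral_mult_right)
  then show "integrable M Z" "expectation Z = 0"
    by (auto simp: has_bochner_integral_iff Z_def)
  have "has_bochner_integral M (\<lambda>w. X w ^ 4 + 4 * c * X w ^ 3 + (4 * c\<^sup>2 - 2 * s\<^sup>2) * X w ^ 2
      - 4 * c * s\<^sup>2 * X w ^ 1 + s ^ 4)
    (3 * s ^ 4 + 4 * c * 0 + (4 * c\<^sup>2 - 2 * s\<^sup>2) * s\<^sup>2 - 4 * c * s\<^sup>2 * 0 + s ^ 4)"
    by (intro has_bochner_integral_add has_bochner_integral_diff m0 m1 m2 m3 m4 has_bochner_integral_mult_right)
  moreover have "(\<lambda>w. X w ^ 4 + 4 * c * X w ^ 3 + (4 * c\<^sup>2 - 2 * s\<^sup>2) * X w ^ 2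
      - 4 * c * s\<^sup>2 * X w ^ 1 + s ^ 4) = (\<lambda>w. (Z w)\<^sup>2)"
    by (auto simp: Z_def power2_eq_square power4_eq_xxxx power3_eq_cube algebra_simps)
  moreover have "3 * s ^ 4 + 4 * c * 0 + (4 * c\<^sup>2 - 2 * s\<^sup>2) * s\<^sup>2 - 4 * c * s\<^sup>2 * 0 + s ^ 4
      = 2 * s ^ 4 + 4 * c\<^sup>2 * s\<^sup>2"
    by (simp add: power2_eq_square power4_eq_xxxx algebra_simps)
  ultimately show "integrable M (\<lambda>w. (Z w)\<^sup>2)" "expectation (\<lambda>w. (Z w)\<^sup>2) = 2 * s ^ 4 + 4 * c\<^sup>2 * s\<^sup>2"
    by (auto simp: has_bochner_integral_iff)
qed

section \<open>A maximal inequality\<close>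

fun run_max :: "(nat \<Rightarrow> real) \<Rightarrow> nat \<Rightarrow> real" where
  "run_max s 0 = 0"
| "run_max s (Suc k) = max (run_max s k) (s (Suc k))"

lemma run_max_ge: "s 0 = 0 \<Longrightarrow> j \<le> k \<Longrightarrow> s j \<le> run_max s k"
  by (induction k) (auto simp: le_Suc_eq max_def intro: order_trans)

lemma run_max_cong: "(\<And>j. j \<le> k \<Longrightarrow> s j = t j) \<Longrightarrow> run_max s k = run_max t k"
  by (induction k) auto

text \<open>A crude bound whose only purpose is integrability: it dominates the squared running
  maximum by a finite sum of integrable squares.\<close>

lemma run_max_square_le: "(run_max s k)\<^sup>2 \<le> (\<Sum>j\<le>k. (s j)\<^sup>2)"
proof (induction k)
  case (Suc k)
  have "(run_max s (Suc k))\<^sup>2 \<le> (run_max s k)\<^sup>2 + (s (Suc k))\<^sup>2"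
    by (simp add: max_def)
  with Suc show ?case by simp
qed simp

text \<open>The pathwise form of Doob's \<open>L\<^sup>2\<close> inequality: for a martingale \<open>s\<close> the last sum
  has expectation 0.\<close>

lemma run_max_pathwise:
  assumes "s 0 = 0"
  shows "(run_max s n)\<^sup>2 \<le> 4 * (s n)\<^sup>2 - 4 * (\<Sum>k<n. run_max s k * (s (Suc k) - s k))"
proof -
  let ?P = "run_max s"
  have "(?P n)\<^sup>2 \<le> 2 * (?P n * s n) - 2 * (\<Sum>k<n. ?P k * (s (Suc k) - s k))"
  proof (induction n)
    case (Suc n)
    \<comment> \<open>The running maximum moves only when \<open>s\<close> sets a new record, and
      then it equals \<open>s (Suc n)\<close>; the two sides differ by a perfect square. The right
      side is exactly the increment of the bound in the induction.\<close>
    have "(?P (Suc n))\<^sup>2 - (?P n)\<^sup>2 \<le> 2 * ((?P (Suc n) - ?P n) * s (Suc n))"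
    proof (cases "?P n \<le> s (Suc n)")
      case True
      then have "2 * ((?P (Suc n) - ?P n) * s (Suc n)) - ((?P (Suc n))\<^sup>2 - (?P n)\<^sup>2) = (s (Suc n) - ?P n)\<^sup>2"
        by (simp add: max_def power2_eq_square algebra_simps)
      then show ?thesis by (smt (verit) zero_le_power2)
    qed (simp add: max_def)
    with Suc show ?case by (simp only: sum.lessThan_Suc) (simp only: algebra_simps)
  qed simp
  \<comment> \<open>Young's inequality balanced so that half of \<open>(?P n)\<^sup>2\<close> can be
    absorbed on the left; doubling afterwards produces the constant 4.\<close>
  moreover have "2 * (?P n * s n) \<le> (?P n)\<^sup>2 / 2 + 2 * (s n)\<^sup>2"
  proof -
    have "0 \<le> (?P n - 2 * s n)\<^sup>2" by simp
    then show ?thesis by (simp add: power2_eq_square algebra_simps)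
  qed
  ultimately show ?thesis by linarith
qed

lemma measurable_run_max [measurable (raw)]:
  assumes "\<And>j. j \<le> k \<Longrightarrow> (\<lambda>w. f w j) \<in> borel_measurable N"
  shows "(\<lambda>w. run_max (f w) k) \<in> borel_measurable N"
  using assms by (induction k) auto

text \<open>Orthogonality of martingale increments. The past factor is given as \<open>F\<close> of
  the tuple of earlier variables, so that independence of disjoint blocks of indices
  applies.\<close>

lemma (in prob_space) expectation_past_times_centered:
  fixes Z :: "nat \<Rightarrow> 'a \<Rightarrow> real"
  assumes ind: "indep_vars (\<lambda>_. borel) Z {..<n}" and k: "k < n"
    and F: "F \<in> borel_measurable (Pi\<^sub>M {..<k} (\<lambda>_. borel))"
    and iF: "integrable M (\<lambda>w. F (\<lambda>i\<in>{..<k}. Z i w))"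
    and iZ: "integrable M (Z k)" and eZ: "expectation (Z k) = 0"
  shows "expectation (\<lambda>w. F (\<lambda>i\<in>{..<k}. Z i w) * Z k w) = (0 :: real)"
proof -
  have "indep_var (Pi\<^sub>M {..<k} (\<lambda>_. borel)) (\<lambda>w. \<lambda>i\<in>{..<k}. Z i w) (Pi\<^sub>M {k} (\<lambda>_. borel)) (\<lambda>w. \<lambda>i\<in>{k}. Z i w)"
    using k by (intro indep_var_restrict[OF ind]) auto
  moreover have "(\<lambda>x. x k) \<in> borel_measurable (Pi\<^sub>M {k} (\<lambda>_. borel :: real measure))"
    by measurable
  ultimately have "indep_var borel (F \<circ> (\<lambda>w. \<lambda>i\<in>{..<k}. Z i w)) borel ((\<lambda>x. x k) \<circ> (\<lambda>w. \<lambda>i\<in>{k}. Z i w))"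
    using F by (intro indep_var_compose)
  then have "indep_var borel (\<lambda>w. F (\<lambda>i\<in>{..<k}. Z i w)) borel (Z k)"
    by (simp add: comp_def)
  from indep_var_lebesgue_integral[OF this iF iZ] eZ show ?thesis by simp
qed

lemma integrable_mult_of_square_integrable:
  fixes f g :: "'a \<Rightarrow> real"
  assumes [measurable]: "f \<in> borel_measurable M" "g \<in> borel_measurable M"
    and "integrable M (\<lambda>w. (f w)\<^sup>2)" "integrable M (\<lambda>w. (g w)\<^sup>2)"
  shows "integrable M (\<lambda>w. f w * g w)"
proof (rule Bochner_Integration.integrable_bound)
  show "integrable M (\<lambda>w. (f w)\<^sup>2 + (g w)\<^sup>2)" using assms by simp
  show "AE w in M. norm (f w * g w) \<le> norm ((f w)\<^sup>2 + (g w)\<^sup>2)"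
  proof (rule AE_I2)
    fix w
    have "0 \<le> (\<bar>f w\<bar> - \<bar>g w\<bar>)\<^sup>2" by simp
    then have "2 * (\<bar>f w\<bar> * \<bar>g w\<bar>) \<le> (f w)\<^sup>2 + (g w)\<^sup>2"
      by (simp add: power2_diff)
    moreover have "0 \<le> \<bar>f w\<bar> * \<bar>g w\<bar>" by simp
    ultimately show "norm (f w * g w) \<le> norm ((f w)\<^sup>2 + (g w)\<^sup>2)"
      unfolding real_norm_def abs_mult by linarith
  qed
qed measurable

context prob_space
begin

context
  fixes Z :: "nat \<Rightarrow> 'a \<Rightarrow> real" and n :: nat
  assumes ind: "indep_vars (\<lambda>_. borel) Z {..<n}"
    and sqi: "\<And>i. i < n \<Longrightarrow> integrable M (\<lambda>w. (Z i w)\<^sup>2)"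
    and centered: "\<And>i. i < n \<Longrightarrow> expectation (Z i) = 0"
begin

lemma measurable_summand [measurable]: "i < n \<Longrightarrow> Z i \<in> borel_measurable M"
  using ind by (auto simp: indep_vars_def)

lemma integrable_summand: "i < n \<Longrightarrow> integrable M (Z i)"
  by (rule square_integrable_imp_integrable[OF _ sqi]) auto

lemma measurable_partial_sum: "k \<le> n \<Longrightarrow> (\<lambda>w. \<Sum>i<k. Z i w) \<in> borel_measurable M"
  by (intro borel_measurable_sum) auto

text \<open>Expanding the square, the mixed term is a function of the past times a centred increment
  and has expectation 0.\<close>

lemma partial_sum_second_moment:
  "k \<le> n \<Longrightarrow> integrable M (\<lambda>w. (\<Sum>i<k. Z i w)\<^sup>2) \<and>
    expectation (\<lambda>w. (\<Sum>i<k. Z i w)\<^sup>2) = (\<Sum>i<k. expectation (\<lambda>w. (Z i w)\<^sup>2))"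
proof (induction k)
  case (Suc k)
  let ?S = "\<lambda>w. \<Sum>i<k. Z i w"
  have k: "k < n" using Suc by simp
  have iS2: "integrable M (\<lambda>w. (?S w)\<^sup>2)" using Suc by simp
  have mS: "?S \<in> borel_measurable M" using k by (intro measurable_partial_sum) simp
  have iS: "integrable M ?S" by (rule square_integrable_imp_integrable[OF mS iS2])
  have iSZ: "integrable M (\<lambda>w. ?S w * Z k w)"
    using mS iS2 sqi[OF k] k by (intro integrable_mult_of_square_integrable) auto
  have "expectation (\<lambda>w. (\<lambda>x. \<Sum>i<k. x i) (\<lambda>i\<in>{..<k}. Z i w) * Z k w) = 0"
  proof (rule expectation_past_times_centered[OF ind k _ _ integrable_summand[OF k] centered[OF k]])
    show "(\<lambda>x. \<Sum>i<k. x i) \<in> borel_measurable (Pi\<^sub>M {..<k} (\<lambda>_. borel :: real measure))"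
      by measurable
    show "integrable M (\<lambda>w. \<Sum>i<k. (\<lambda>i\<in>{..<k}. Z i w) i)" using iS by simp
  qed
  then have cross: "expectation (\<lambda>w. ?S w * Z k w) = 0" by simp
  have eq: "(\<lambda>w. (\<Sum>i<Suc k. Z i w)\<^sup>2) = (\<lambda>w. (?S w)\<^sup>2 + 2 * (?S w * Z k w) + (Z k w)\<^sup>2)"
    by (auto simp: power2_sum)
  show ?case
    unfolding eq using iS2 iSZ sqi[OF k] cross Suc by simp
qed simp

text \<open>The increments in the pathwise inequality are the \<open>Z k\<close>, and the running
  maximum up to \<open>k\<close> involves \<open>Z i\<close> for \<open>i < k\<close> only. Each
  correction term thus has mean 0, leaving four times the second moment of the last partial
  sum.\<close>

lemma run_max_partial_sums:
  shows "integrable M (\<lambda>w. (run_max (\<lambda>j. \<Sum>i<j. Z i w) n)\<^sup>2)"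
    and "expectation (\<lambda>w. (run_max (\<lambda>j. \<Sum>i<j. Z i w) n)\<^sup>2) \<le> 4 * (\<Sum>i<n. expectation (\<lambda>w. (Z i w)\<^sup>2))"
proof -
  let ?S = "\<lambda>w j. \<Sum>i<j. Z i w"
  have mP [measurable]: "(\<lambda>w. run_max (?S w) k) \<in> borel_measurable M" if "k \<le> n" for k
    using that by (intro measurable_run_max measurable_partial_sum) auto
  have iP2: "integrable M (\<lambda>w. (run_max (?S w) k)\<^sup>2)" if k: "k \<le> n" for k
  proof (rule Bochner_Integration.integrable_bound)
    show "integrable M (\<lambda>w. \<Sum>j\<le>k. (?S w j)\<^sup>2)"
      using k partial_sum_second_moment by (intro Bochner_Integration.integrable_sum) auto
    show "AE w in M. norm ((run_max (?S w) k)\<^sup>2) \<le> norm (\<Sum>j\<le>k. (?S w j)\<^sup>2)"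
      using run_max_square_le[of "?S _" k] by (auto simp: sum_nonneg)
  qed (use mP[OF k] in auto)
  show "integrable M (\<lambda>w. (run_max (?S w) n)\<^sup>2)" by (rule iP2) simp
  have iPZ: "integrable M (\<lambda>w. run_max (?S w) k * Z k w)" if k: "k < n" for k
    using k mP[of k] iP2[of k] sqi[OF k] by (intro integrable_mult_of_square_integrable) auto
  have ePZ: "expectation (\<lambda>w. run_max (?S w) k * Z k w) = 0" if k: "k < n" for k
  proof -
    \<comment> \<open>The running maximum as a function of the past tuple: partial sums up to index
      \<open>k\<close> use no entry beyond \<open>k - 1\<close>.\<close>
    let ?F = "\<lambda>x :: nat \<Rightarrow> real. run_max (\<lambda>j. \<Sum>i<j. x i) k"
    have F: "?F (\<lambda>i\<in>{..<k}. Z i w) = run_max (?S w) k" for w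
      by (intro run_max_cong sum.cong) auto
    have iP: "integrable M (\<lambda>w. run_max (?S w) k)"
      using k by (intro square_integrable_imp_integrable[OF mP iP2]) auto
    have "?F \<in> borel_measurable (Pi\<^sub>M {..<k} (\<lambda>_. borel))"
      by (intro measurable_run_max borel_measurable_sum measurable_component_singleton) auto
    from expectation_past_times_centered[OF ind k this _ integrable_summand[OF k] centered[OF k]] iP
    show ?thesis unfolding F by simp
  qed
  have iS2: "integrable M (\<lambda>w. (?S w n)\<^sup>2)" using partial_sum_second_moment by simp
  have "expectation (\<lambda>w. (run_max (?S w) n)\<^sup>2)
      \<le> expectation (\<lambda>w. 4 * (?S w n)\<^sup>2 - 4 * (\<Sum>k<n. run_max (?S w) k * Z k w))"
  proof (rule integral_mono)
    fix w
    show "(run_max (?S w) n)\<^sup>2 \<le> 4 * (?S w n)\<^sup>2 - 4 * (\<Sum>k<n. run_max (?S w) k * Z k w)"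
      using run_max_pathwise[of "?S w" n] by simp
  qed (use iP2 iS2 iPZ in \<open>auto intro!: Bochner_Integration.integrable_diff
    Bochner_Integration.integrable_mult_right Bochner_Integration.integrable_sum\<close>)
  also have "\<dots> = 4 * expectation (\<lambda>w. (?S w n)\<^sup>2) - 4 * (\<Sum>k<n. expectation (\<lambda>w. run_max (?S w) k * Z k w))"
    using iS2 iPZ by (subst Bochner_Integration.integral_diff) auto
  also have "\<dots> = 4 * (\<Sum>i<n. expectation (\<lambda>w. (Z i w)\<^sup>2))"
    using partial_sum_second_moment[of n] ePZ by simp
  finally show "expectation (\<lambda>w. (run_max (?S w) n)\<^sup>2) \<le> 4 * (\<Sum>i<n. expectation (\<lambda>w. (Z i w)\<^sup>2))" .
qed

end

end

text \<open>The running maximum is one-sided, so it is used for \<open>Z\<close> and for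
  \<open>- Z\<close>; the constant is 8 = 4 + 4. Taking \<open>K\<close> as the root of the sum of
  both squares dominates each of them and leaves a square that integrates at once.\<close>

lemma (in prob_space) weighted_sums_sup_bound:
  fixes Z :: "nat \<Rightarrow> 'a \<Rightarrow> real"
  assumes ind: "indep_vars (\<lambda>_. borel) Z {..<n}"
    and sqi: "\<And>i. i < n \<Longrightarrow> integrable M (\<lambda>w. (Z i w)\<^sup>2)"
    and centered: "\<And>i. i < n \<Longrightarrow> expectation (Z i) = 0"
  obtains K where "integrable M (\<lambda>w. (K w)\<^sup>2)"
    "expectation (\<lambda>w. (K w)\<^sup>2) \<le> 8 * (\<Sum>i<n. expectation (\<lambda>w. (Z i w)\<^sup>2))"
    "\<And>w k. k \<le> n \<Longrightarrow> \<bar>\<Sum>i<k. Z i w\<bar> \<le> K w"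
proof -
  let ?P = "\<lambda>w. run_max (\<lambda>j. \<Sum>i<j. Z i w) n"
  let ?N = "\<lambda>w. run_max (\<lambda>j. \<Sum>i<j. - Z i w) n"
  have indN: "indep_vars (\<lambda>_. borel) (\<lambda>i w. - Z i w) {..<n}"
    by (rule indep_vars_compose2[OF ind, where Y="\<lambda>_. uminus"]) auto
  note P = run_max_partial_sums[of Z n, OF ind sqi centered]
  have N: "integrable M (\<lambda>w. (?N w)\<^sup>2)"
    "expectation (\<lambda>w. (?N w)\<^sup>2) \<le> 4 * (\<Sum>i<n. expectation (\<lambda>w. (Z i w)\<^sup>2))"
    using run_max_partial_sums[of "\<lambda>i w. - Z i w" n, OF indN] sqi centered by auto
  show ?thesis
  proof (rule that[of "\<lambda>w. sqrt ((?P w)\<^sup>2 + (?N w)\<^sup>2)"])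
    show "integrable M (\<lambda>w. (sqrt ((?P w)\<^sup>2 + (?N w)\<^sup>2))\<^sup>2)"
      using P(1) N(1) by simp
    show "expectation (\<lambda>w. (sqrt ((?P w)\<^sup>2 + (?N w)\<^sup>2))\<^sup>2) \<le> 8 * (\<Sum>i<n. expectation (\<lambda>w. (Z i w)\<^sup>2))"
      using P N by simp
  next
    fix w k assume k: "k \<le> n"
    have "(\<Sum>i<k. Z i w) \<le> ?P w" using run_max_ge[of "\<lambda>j. \<Sum>i<j. Z i w" k n] k by simp
    moreover have "?P w \<le> sqrt ((?P w)\<^sup>2 + (?N w)\<^sup>2)" by (rule real_sqrt_sum_squares_ge1)
    moreover have "- (\<Sum>i<k. Z i w) \<le> ?N w"
      using run_max_ge[of "\<lambda>j. \<Sum>i<j. - Z i w" k n] k by (simp add: sum_negf)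
    moreover have "?N w \<le> sqrt ((?P w)\<^sup>2 + (?N w)\<^sup>2)" by (rule real_sqrt_sum_squares_ge2)
    ultimately show "\<bar>\<Sum>i<k. Z i w\<bar> \<le> sqrt ((?P w)\<^sup>2 + (?N w)\<^sup>2)" by linarith
  qed
qed

section \<open>The deviation of the discrepancy\<close>

text \<open>Induction subtracts the smallest weight \<open>q n\<close> from all the others, which
  leaves decreasing weights in \<open>[0, b - q n]\<close>, and \<open>q n\<close> multiplies the
  full sum. The bounds \<open>(b - q n) * K\<close> and \<open>q n * K\<close> add up, which is why
  \<open>b\<close> varies in the induction.\<close>

lemma abel_summation_bound:
  fixes q z :: "nat \<Rightarrow> real"
  assumes "\<And>i. i < n \<Longrightarrow> 0 \<le> q i" "\<And>i. i < n \<Longrightarrow> q i \<le> b" "0 \<le> b"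
    and "\<And>i j. i \<le> j \<Longrightarrow> j < n \<Longrightarrow> q j \<le> q i"
    and "\<And>k. k \<le> n \<Longrightarrow> \<bar>\<Sum>i<k. z i\<bar> \<le> K"
  shows "\<bar>\<Sum>i<n. q i * z i\<bar> \<le> b * K"
  using assms
proof (induction n arbitrary: q b)
  case 0
  then show ?case by (auto intro!: mult_nonneg_nonneg)
next
  case (Suc n)
  have "\<bar>\<Sum>i<n. (q i - q n) * z i\<bar> \<le> (b - q n) * K"
    using Suc.prems by (intro Suc.IH) auto
  moreover have "\<bar>q n * (\<Sum>i<Suc n. z i)\<bar> \<le> q n * K"
    using Suc.prems(1)[of n] Suc.prems(5)[of "Suc n"] by (simp add: abs_mult mult_left_mono)
  moreover have "(\<Sum>i<Suc n. q i * z i) = (\<Sum>i<n. (q i - q n) * z i) + q n * (\<Sum>i<Suc n. z i)"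
    by (simp add: left_diff_distrib sum_subtractf sum_distrib_left distrib_left)
  ultimately show ?case by (simp only: left_diff_distrib)
qed

section \<open>The spectral weights as functions of the eigenvalue and of \<alpha>\<close>

definition dp_weight :: "real \<Rightarrow> real \<Rightarrow> real" where
  "dp_weight l \<alpha> = (1 - l / (l + \<alpha>))\<^sup>2"

lemma one_minus_ratio_bounds:
  fixes l \<alpha> :: real
  assumes "0 \<le> l" "0 \<le> \<alpha>"
  shows "0 \<le> 1 - l / (l + \<alpha>)" "1 - l / (l + \<alpha>) \<le> 1"
proof -
  have "0 \<le> l / (l + \<alpha>)" using assms by simp
  moreover have "l / (l + \<alpha>) \<le> 1"
  proof (cases "l + \<alpha> = 0")
    case False
    then have "0 < l + \<alpha>" using assms by simp
    then show ?thesis using assms by (simp add: divide_le_eq_1)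
  qed simp
  ultimately show "0 \<le> 1 - l / (l + \<alpha>)" "1 - l / (l + \<alpha>) \<le> 1" by auto
qed

lemma dp_weight_nonneg: "0 \<le> dp_weight l \<alpha>"
  by (simp add: dp_weight_def)

lemma dp_weight_le_1: "0 \<le> l \<Longrightarrow> 0 \<le> \<alpha> \<Longrightarrow> dp_weight l \<alpha> \<le> 1"
  unfolding dp_weight_def by (intro power_le_one one_minus_ratio_bounds)

lemma dp_weight_antimono:
  assumes "0 \<le> l" "l \<le> l'" "0 \<le> \<alpha>"
  shows "dp_weight l' \<alpha> \<le> dp_weight l \<alpha>"
proof -
  have "l / (l + \<alpha>) \<le> l' / (l' + \<alpha>)"
  proof (cases "l = 0")
    case False
    then have "0 < l + \<alpha>" "0 < l' + \<alpha>" using assms by auto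
    then show ?thesis using assms mult_left_mono[of l l' \<alpha>] by (simp add: field_simps)
  qed (use assms in simp)
  then show ?thesis
    unfolding dp_weight_def using one_minus_ratio_bounds(1)[of l' \<alpha>] assms by (intro power_mono) auto
qed

text \<open>The endpoint 0 is the delicate one. For \<open>l = 0\<close> the weight is constantly 1,
  also at \<alpha> = 0 by the convention \<open>0 / 0 = 0\<close>; for \<open>l > 0\<close> the
  denominator never vanishes.\<close>

lemma dp_weight_continuous:
  assumes "0 \<le> l"
  shows "continuous_on {0..} (dp_weight l)"
proof (cases "l = 0")
  case True
  then show ?thesis by (simp add: dp_weight_def[abs_def])
next
  case False
  then show ?thesis
    unfolding dp_weight_def[abs_def] using assms by (intro continuous_intros) auto
qed

section \<open>From suprema over a half-line to countable suprema\<close>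

lemma closure_nonneg_rationals: "closure (\<rat> \<inter> {0..}) = {0 :: real..}"
proof
  show "closure (\<rat> \<inter> {0..}) \<subseteq> {0 :: real..}" by (intro closure_minimal) auto
  show "{0 :: real..} \<subseteq> closure (\<rat> \<inter> {0..})"
  proof
    fix x :: real assume x: "x \<in> {0..}"
    show "x \<in> closure (\<rat> \<inter> {0..})"
      unfolding closure_approachable
    proof (intro allI impI)
      fix e :: real assume "e > 0"
      then obtain r where "r \<in> \<rat>" "x < r" "r < x + e" using Rats_dense_in_real[of x "x + e"] by auto
      then show "\<exists>y\<in>\<rat> \<inter> {0..}. dist y x < e" using x by (intro bexI[of _ r]) (auto simp: dist_real_def)
    qed
  qed
qed

text \<open>Serves measurability: a countable supremum of measurable functions is measurable. A
  bound valid on a dense subset extends to the closure by continuity.\<close>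

lemma SUP_nonneg_eq_SUP_rationals:
  fixes g :: "real \<Rightarrow> real"
  assumes g: "continuous_on {0..} g" and bdd: "bdd_above (g ` {0..})"
  shows "(SUP \<alpha>\<in>{0..}. g \<alpha>) = (SUP \<alpha>\<in>\<rat> \<inter> {0..}. g \<alpha>)"
proof (rule antisym)
  have bdd': "bdd_above (g ` (\<rat> \<inter> {0..}))" by (rule bdd_above_mono[OF bdd]) auto
  show "(SUP \<alpha>\<in>{0..}. g \<alpha>) \<le> (SUP \<alpha>\<in>\<rat> \<inter> {0..}. g \<alpha>)"
  proof (rule cSUP_least)
    fix x :: real assume "x \<in> {0..}"
    then have "continuous_on (closure (\<rat> \<inter> {0..})) g" "x \<in> closure (\<rat> \<inter> {0..})"
      using g by (simp_all only: closure_nonneg_rationals)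
    then show "g x \<le> (SUP \<alpha>\<in>\<rat> \<inter> {0..}. g \<alpha>)"
      by (rule continuous_le_on_closure) (rule cSUP_upper[OF _ bdd'])
  qed simp
  show "(SUP \<alpha>\<in>\<rat> \<inter> {0..}. g \<alpha>) \<le> (SUP \<alpha>\<in>{0..}. g \<alpha>)"
    by (rule cSUP_subset_mono[OF _ bdd]) auto
qed

text \<open>Markov's inequality for the square gives a tail of at most c / T^2 for all large
  \<open>m\<close>, uniformly in \<open>m\<close>. Conditions from an index \<open>N\<close> on are
  enough because a limit superior ignores finitely many terms.\<close>

lemma bigO_prob_of_second_moment:
  assumes prob: "\<And>m. m \<ge> N \<Longrightarrow> prob_space (M m)" and r: "\<And>m. m \<ge> N \<Longrightarrow> 0 < r m"
    and Z: "\<And>m. m \<ge> N \<Longrightarrow> Z m \<in> borel_measurable (M m)"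
    and Z2: "\<And>m. m \<ge> N \<Longrightarrow> integrable (M m) (\<lambda>w. (Z m w)\<^sup>2)"
    and bound: "(\<lambda>m. \<integral>w. (Z m w)\<^sup>2 \<partial>(M m)) \<in> O(\<lambda>m. (r m)\<^sup>2)"
  shows "bigO_prob M Z r"
proof -
  from bound obtain c where c: "c > 0"
    and ev: "eventually (\<lambda>m. norm (\<integral>w. (Z m w)\<^sup>2 \<partial>(M m)) \<le> c * norm ((r m)\<^sup>2)) sequentially"
    by (elim landau_o.bigE)
  let ?p = "\<lambda>T m. measure (M m) {w \<in> space (M m). \<bar>Z m w\<bar> > T * r m}"
  have le: "limsup (\<lambda>m. ereal (?p T m)) \<le> ereal (c / T\<^sup>2)" if T: "T > 0" for T
  proof (rule Limsup_bounded)
    show "\<forall>\<^sub>F m in sequentially. ereal (?p T m) \<le> ereal (c / T\<^sup>2)"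
      using ev eventually_ge_at_top[of N]
    proof eventually_elim
      case (elim m)
      interpret prob_space "M m" using elim prob by simp
      note [measurable] = Z[OF elim(2)]
      have a: "0 < T * r m" using T r[OF elim(2)] by simp
      have "?p T m \<le> measure (M m) {w \<in> space (M m). (Z m w)\<^sup>2 \<ge> (T * r m)\<^sup>2}"
        using a by (intro finite_measure_mono) (auto simp: abs_le_square_iff[symmetric])
      also have "\<dots> \<le> expectation (\<lambda>w. (Z m w)\<^sup>2) / (T * r m)\<^sup>2"
        using a Z2[OF elim(2)] by (intro integral_Markov_inequality_measure[where A="{}"]) auto
      also have "\<dots> \<le> (c * (r m)\<^sup>2) / (T * r m)\<^sup>2"
        using elim(1) by (intro divide_right_mono) auto
      also have "\<dots> = c / T\<^sup>2" using r[OF elim(2)] by (simp add: power_mult_distrib)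
      finally show ?case by simp
    qed
  qed
  have ge: "0 \<le> limsup (\<lambda>m. ereal (?p T m))" for T
    by (intro le_Limsup) auto
  have "((\<lambda>T. c / T\<^sup>2) \<longlongrightarrow> 0) at_top"
    by (intro tendsto_divide_0[OF tendsto_const] filterlim_at_top_imp_at_infinity
      filterlim_pow_at_top filterlim_ident) auto
  then have "((\<lambda>T. ereal (c / T\<^sup>2)) \<longlongrightarrow> ereal 0) at_top" by (intro tendsto_ereal)
  then have lim: "((\<lambda>T. ereal (c / T\<^sup>2)) \<longlongrightarrow> 0) at_top" by (simp add: zero_ereal_def)
  show ?thesis
    unfolding bigO_prob_def
  proof (rule tendsto_sandwich[OF _ _ tendsto_const lim])
    show "\<forall>\<^sub>F T in at_top. limsup (\<lambda>m. ereal (?p T m)) \<le> ereal (c / T\<^sup>2)"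
      using eventually_gt_at_top[of 0] by eventually_elim (rule le)
  qed (simp add: ge)
qed

text \<open>The estimate for one fixed dimension, with explicit constants: 8 comes from the
  two-sided maximal inequality, the bracket bounds the sum of the variances of the
  \<open>Z i\<close>, and the denominator is the square of the normalization 1/m.\<close>

lemma (in prob_space) sup_DP_deviation_bounds:
  fixes A :: "real mat" and x :: "real vec" and e Y :: "'a \<Rightarrow> real vec"
  assumes m: "m \<ge> 1" and sigma: "\<sigma>\<^sup>2 > 0"
    and A_dim: "A \<in> carrier_mat m m" and x_dim: "x \<in> carrier_vec m"
    and noise: "multivariate_normal M e (0\<^sub>v m) (\<sigma>\<^sup>2 \<cdot>\<^sub>m 1\<^sub>m m)"
    and model: "\<And>w. w \<in> space M \<Longrightarrow> Y w = A *\<^sub>v x + e w"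
    and sing: "has_singular_values A gam" and gam: "\<And>j. j \<in> {1..m} \<Longrightarrow> gam j \<le> 1"
  shows "\<And>\<alpha>. \<alpha> \<ge> 0 \<Longrightarrow> integrable M (\<lambda>w. DP \<sigma> A \<alpha> (Y w))"
    "\<And>w. w \<in> space M \<Longrightarrow> bdd_above ((\<lambda>\<alpha>. DP_deviation M \<sigma> A Y \<alpha> w) ` {0..})"
    "sup_DP_deviation M \<sigma> A Y \<in> borel_measurable M"
    "integrable M (\<lambda>w. (sup_DP_deviation M \<sigma> A Y w)\<^sup>2)"
    "expectation (\<lambda>w. (sup_DP_deviation M \<sigma> A Y w)\<^sup>2)
      \<le> 8 * (2 * real m * \<sigma> ^ 4 + 4 * \<sigma>\<^sup>2 * (x \<bullet> x)) / (real m)\<^sup>2"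
proof -
  obtain u lam where basis: "left_singular_basis m u A lam"
    and lam_mono: "\<And>i j. i \<le> j \<Longrightarrow> j < m \<Longrightarrow> lam i \<le> lam j"
    using left_singular_basis_exists[OF A_dim] by blast
  interpret left_singular_basis m u A lam by (rule basis)
  define s where "s = \<bar>\<sigma>\<bar>"
  have s: "s > 0" and s2: "s\<^sup>2 = \<sigma>\<^sup>2" and s4: "s ^ 4 = \<sigma> ^ 4" using sigma by (auto simp: s_def)
  define X where "X = (\<lambda>w. \<lambda>i\<in>{..<m}. e w $ i)"
  have e: "e w \<in> carrier_vec m" if "w \<in> space M" for w
    using noise that by (simp add: multivariate_normal_def)
  have X: "distributed M (Pi\<^sub>M {..<m} (\<lambda>_. lborel)) X (gauss_density {..<m} s)"
    using noise unfolding multivariate_normal_def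
    by (simp add: X_def s_def multivariate_normal_density_scalar[OF sigma])
  define R where "R = (\<lambda>i j. u i $ j)"
  define E where "E = (\<lambda>i w. lin_map {..<m} R (X w) i)"
  have ne: "{..<m} \<noteq> {}" using m by (auto simp: lessThan_empty_iff)
  have R1: "(\<Sum>j\<in>{..<m}. R i j * R k j) = (if i = k then 1 else 0)" if "i \<in> {..<m}" "k \<in> {..<m}" for i k
    using row_orthonormal that by (simp add: R_def)
  have R2: "(\<Sum>i\<in>{..<m}. R i j * R i k) = (if j = k then 1 else 0)" if "j \<in> {..<m}" "k \<in> {..<m}" for j k
    using column_orthonormal that by (simp add: R_def)
  have indE: "indep_vars (\<lambda>_. borel) E {..<m}"
    unfolding E_def by (rule rotated_gauss(1)[OF finite_lessThan ne s R1 R2 X])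
  have distE: "distributed M lborel (E i) (\<lambda>t. ennreal (normal_density 0 s t))" if "i < m" for i
    unfolding E_def using that by (intro rotated_gauss(2)[OF finite_lessThan ne s R1 R2 X]) auto
  define b where "b = (\<lambda>i. u i \<bullet> (A *\<^sub>v x))"
  have Ax: "A *\<^sub>v x \<in> carrier_vec m" using A x_dim by simp
  have Y_carrier: "Y w \<in> carrier_vec m" if "w \<in> space M" for w
    using model[OF that] Ax e[OF that] by simp
  have uY: "u i \<bullet> Y w = b i + E i w" if "i < m" "w \<in> space M" for i w
  proof -
    have "u i \<bullet> e w = E i w"
      using that e[OF that(2)] by (simp add: E_def lin_map_def X_def R_def scalar_prod_def atLeast0LessThan)
    then show ?thesis
      unfolding model[OF that(2)] b_def
      using u_carrier[OF that(1)] Ax e[OF that(2)] by (simp add: scalar_prod_add_distrib[of _ m])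
  qed
  \<comment> \<open>This is \<open>(b i + E i w)\<^sup>2\<close> minus its mean
    \<open>s\<^sup>2 + (b i)\<^sup>2\<close>.\<close>
  define Z where "Z = (\<lambda>i w. (E i w)\<^sup>2 - s\<^sup>2 + 2 * b i * E i w)"
  note Z_props = normal_square_deviation[OF s distE]
  have indZ: "indep_vars (\<lambda>_. borel) Z {..<m}"
    unfolding Z_def by (rule indep_vars_compose2[OF indE, where Y="\<lambda>i t. t\<^sup>2 - s\<^sup>2 + 2 * b i * t"]) measurable
  have iZ: "integrable M (Z i)" if "i < m" for i using Z_props(1)[OF that, where c="b i"] by (simp add: Z_def)
  have eZ: "expectation (Z i) = 0" if "i < m" for i using Z_props(2)[OF that, where c="b i"] by (simp add: Z_def)
  have iZ2: "integrable M (\<lambda>w. (Z i w)\<^sup>2)" if "i < m" for i using Z_props(3)[OF that, where c="b i"] by (simp add: Z_def)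
  have eZ2: "expectation (\<lambda>w. (Z i w)\<^sup>2) = 2 * s ^ 4 + 4 * (b i)\<^sup>2 * s\<^sup>2" if "i < m" for i
    using Z_props(4)[OF that, where c="b i"] by (simp add: Z_def)
  let ?q = "\<lambda>i. dp_weight (lam i)"
  \<comment> \<open>The deterministic part of the discrepancy; it turns out to be the expectation,
    since the \<open>Z i\<close> are centred.\<close>
  define D where "D = (\<lambda>\<alpha>. (\<Sum>i<m. ?q i \<alpha> * (s\<^sup>2 + (b i)\<^sup>2)) - real m * \<sigma>\<^sup>2)"
  have DP: "DP \<sigma> A \<alpha> (Y w) = (\<Sum>i<m. ?q i \<alpha> * Z i w) + D \<alpha>" if "\<alpha> \<ge> 0" "w \<in> space M" for \<alpha> w
  proof -
    have "DP \<sigma> A \<alpha> (Y w) = (\<Sum>i<m. ?q i \<alpha> * (u i \<bullet> Y w)\<^sup>2) - real m * \<sigma>\<^sup>2"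
      unfolding dp_weight_def by (rule DP_eq[OF that(1) Y_carrier[OF that(2)]])
    also have "(\<Sum>i<m. ?q i \<alpha> * (u i \<bullet> Y w)\<^sup>2) = (\<Sum>i<m. ?q i \<alpha> * Z i w + ?q i \<alpha> * (s\<^sup>2 + (b i)\<^sup>2))"
      using that by (intro sum.cong refl) (simp add: uY Z_def power2_eq_square algebra_simps)
    finally show ?thesis by (simp add: D_def sum.distrib)
  qed
  have iS: "integrable M (\<lambda>w. \<Sum>i<m. ?q i \<alpha> * Z i w)" for \<alpha>
    using iZ by (intro Bochner_Integration.integrable_sum integrable_mult_right) auto
  show iDP: "integrable M (\<lambda>w. DP \<sigma> A \<alpha> (Y w))" if "\<alpha> \<ge> 0" for \<alpha>
  proof -
    have "integrable M (\<lambda>w. (\<Sum>i<m. ?q i \<alpha> * Z i w) + D \<alpha>)" using iS[of \<alpha>] by simp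
    then show ?thesis
      using DP[OF that] by (subst Bochner_Integration.integrable_cong) auto
  qed
  have EDP: "EDP M \<sigma> A Y \<alpha> = D \<alpha>" if "\<alpha> \<ge> 0" for \<alpha>
  proof -
    have "EDP M \<sigma> A Y \<alpha> = expectation (\<lambda>w. (\<Sum>i<m. ?q i \<alpha> * Z i w) + D \<alpha>)"
      unfolding EDP_def using DP[OF that] by (intro Bochner_Integration.integral_cong) auto
    also have "\<dots> = (\<Sum>i<m. ?q i \<alpha> * expectation (Z i)) + D \<alpha>"
      using iS[of \<alpha>] iZ by (simp add: prob_space)
    also have "\<dots> = D \<alpha>" using eZ by simp
    finally show ?thesis .
  qed
  have dev: "DP_deviation M \<sigma> A Y \<alpha> w = \<bar>1 / real m * (\<Sum>i<m. ?q i \<alpha> * Z i w)\<bar>"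
    if "\<alpha> \<ge> 0" "w \<in> space M" for \<alpha> w
    unfolding DP_deviation_def DP[OF that] EDP[OF that(1)] using A by simp
  obtain K where K2: "integrable M (\<lambda>w. (K w)\<^sup>2)"
    and EK: "expectation (\<lambda>w. (K w)\<^sup>2) \<le> 8 * (\<Sum>i<m. expectation (\<lambda>w. (Z i w)\<^sup>2))"
    and K: "\<And>w k. k \<le> m \<Longrightarrow> \<bar>\<Sum>i<k. Z i w\<bar> \<le> K w"
    using weighted_sums_sup_bound[OF indZ, of thesis] iZ2 eZ by auto
  have dev_le: "DP_deviation M \<sigma> A Y \<alpha> w \<le> K w / real m" if "\<alpha> \<ge> 0" "w \<in> space M" for \<alpha> w
  proof -
    \<comment> \<open>The bound \<open>K w\<close> does not depend on \<alpha>. This is where the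
      increasing order of \<open>lam\<close> is used: it makes the weights decrease in the index for
      each \<alpha>.\<close>
    have "\<bar>\<Sum>i<m. ?q i \<alpha> * Z i w\<bar> \<le> 1 * K w"
    proof (rule abel_summation_bound)
      fix i j assume "i \<le> j" "j < m"
      then show "?q j \<alpha> \<le> ?q i \<alpha>"
        using that lam_mono lam_nonneg by (intro dp_weight_antimono) auto
    qed (use K that lam_nonneg in \<open>auto intro: dp_weight_nonneg dp_weight_le_1\<close>)
    then show ?thesis
      unfolding dev[OF that] abs_mult by (simp add: divide_right_mono)
  qed
  show bdd: "bdd_above ((\<lambda>\<alpha>. DP_deviation M \<sigma> A Y \<alpha> w) ` {0..})" if "w \<in> space M" for w
    using dev_le[OF _ that] by (intro bdd_aboveI2[where M="K w / real m"]) auto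
  have cont: "continuous_on {0..} (\<lambda>\<alpha>. DP_deviation M \<sigma> A Y \<alpha> w)" if "w \<in> space M" for w
  proof -
    have "continuous_on {0..} (\<lambda>\<alpha>. \<bar>1 / real m * (\<Sum>i<m. ?q i \<alpha> * Z i w)\<bar>)"
      using lam_nonneg by (intro continuous_intros dp_weight_continuous) auto
    then show ?thesis
      using dev[OF _ that] by (subst continuous_on_cong[OF refl]) auto
  qed
  have sup_eq: "sup_DP_deviation M \<sigma> A Y w
      = (SUP \<alpha>\<in>\<rat> \<inter> {0..}. \<bar>1 / real m * (\<Sum>i<m. ?q i \<alpha> * Z i w)\<bar>)" if "w \<in> space M" for w
  proof -
    have "sup_DP_deviation M \<sigma> A Y w = (SUP \<alpha>\<in>\<rat> \<inter> {0..}. DP_deviation M \<sigma> A Y \<alpha> w)"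
      unfolding sup_DP_deviation_def by (rule SUP_nonneg_eq_SUP_rationals[OF cont[OF that] bdd[OF that]])
    also have "\<dots> = (SUP \<alpha>\<in>\<rat> \<inter> {0..}. \<bar>1 / real m * (\<Sum>i<m. ?q i \<alpha> * Z i w)\<bar>)"
      using dev[OF _ that] by (intro SUP_cong) auto
    finally show ?thesis .
  qed
  show meas: "sup_DP_deviation M \<sigma> A Y \<in> borel_measurable M"
  proof (subst measurable_cong[OF sup_eq])
    have "(\<lambda>w. \<Sum>i<m. ?q i \<alpha> * Z i w) \<in> borel_measurable M" for \<alpha>
      using iS by (rule borel_measurable_integrable)
    then have [measurable]: "(\<lambda>w. \<bar>1 / real m * (\<Sum>i<m. ?q i \<alpha> * Z i w)\<bar>) \<in> borel_measurable M" for \<alpha>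
      by measurable
    show "(\<lambda>w. SUP \<alpha>\<in>\<rat> \<inter> {0..}. \<bar>1 / real m * (\<Sum>i<m. ?q i \<alpha> * Z i w)\<bar>) \<in> borel_measurable M"
    proof (rule borel_measurable_cSUP)
      show "countable (\<rat> \<inter> {0::real..})" using countable_rat by (rule countable_subset[rotated]) auto
      fix w assume w: "w \<in> space M"
      show "bdd_above ((\<lambda>\<alpha>. \<bar>1 / real m * (\<Sum>i<m. ?q i \<alpha> * Z i w)\<bar>) ` (\<rat> \<inter> {0..}))"
        using dev_le[OF _ w] dev[OF _ w] by (intro bdd_aboveI2[where M="K w / real m"]) auto
    qed measurable
  qed
  have sup_le: "(sup_DP_deviation M \<sigma> A Y w)\<^sup>2 \<le> (K w)\<^sup>2 / (real m)\<^sup>2" if w: "w \<in> space M" for w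
  proof -
    have "sup_DP_deviation M \<sigma> A Y w \<le> K w / real m"
      unfolding sup_DP_deviation_def using dev_le[OF _ w] by (intro cSUP_least) auto
    \<comment> \<open>Needed for squaring the upper bound; the term at \<alpha> = 0 is already
      nonnegative.\<close>
    moreover have "0 \<le> sup_DP_deviation M \<sigma> A Y w"
      unfolding sup_DP_deviation_def
      by (rule cSUP_upper2[OF bdd[OF w], of 0]) (auto simp: DP_deviation_def)
    ultimately show ?thesis by (simp add: power_mono flip: power_divide)
  qed
  have iK: "integrable M (\<lambda>w. (K w)\<^sup>2 / (real m)\<^sup>2)" using K2 by simp
  show int: "integrable M (\<lambda>w. (sup_DP_deviation M \<sigma> A Y w)\<^sup>2)"
    using meas sup_le by (intro Bochner_Integration.integrable_bound[OF iK]) (auto intro!: AE_I2)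
  have "expectation (\<lambda>w. (sup_DP_deviation M \<sigma> A Y w)\<^sup>2) \<le> expectation (\<lambda>w. (K w)\<^sup>2 / (real m)\<^sup>2)"
    using int iK sup_le by (rule integral_mono)
  also have "\<dots> = expectation (\<lambda>w. (K w)\<^sup>2) / (real m)\<^sup>2" by simp
  also have "\<dots> \<le> 8 * (\<Sum>i<m. expectation (\<lambda>w. (Z i w)\<^sup>2)) / (real m)\<^sup>2"
    using EK by (intro divide_right_mono) auto
  also have "(\<Sum>i<m. expectation (\<lambda>w. (Z i w)\<^sup>2)) = 2 * real m * \<sigma> ^ 4 + 4 * \<sigma>\<^sup>2 * (\<Sum>i<m. (b i)\<^sup>2)"
    by (simp add: eZ2 sum.distrib s2 s4 sum_distrib_left algebra_simps)
  also have "(\<Sum>i<m. (b i)\<^sup>2) = (A *\<^sub>v x) \<bullet> (A *\<^sub>v x)"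
    unfolding b_def by (rule parseval[OF Ax])
  also have "8 * (2 * real m * \<sigma> ^ 4 + 4 * \<sigma>\<^sup>2 * ((A *\<^sub>v x) \<bullet> (A *\<^sub>v x))) / (real m)\<^sup>2
      \<le> 8 * (2 * real m * \<sigma> ^ 4 + 4 * \<sigma>\<^sup>2 * (x \<bullet> x)) / (real m)\<^sup>2"
    using mult_vec_norm_le[OF lam_le_1[OF sing gam] x_dim]
    by (intro divide_right_mono mult_left_mono add_left_mono) auto
  finally show "expectation (\<lambda>w. (sup_DP_deviation M \<sigma> A Y w)\<^sup>2)
      \<le> 8 * (2 * real m * \<sigma> ^ 4 + 4 * \<sigma>\<^sup>2 * (x \<bullet> x)) / (real m)\<^sup>2" .
qed

theorem theorem4:
  fixes M :: "nat \<Rightarrow> 'a measure"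
    and A :: "nat \<Rightarrow> real mat"
    and \<gamma> :: "nat \<Rightarrow> nat \<Rightarrow> real"
    and x :: "nat \<Rightarrow> real vec"
    and \<epsilon> y :: "nat \<Rightarrow> 'a \<Rightarrow> real vec"
    and \<sigma> :: real
  assumes prob: "\<And>m. m \<ge> 1 \<Longrightarrow> prob_space (M m)"
    and sigma: "\<sigma>\<^sup>2 > 0"
    and A_dim: "\<And>m. m \<ge> 1 \<Longrightarrow> A m \<in> carrier_mat m m"
    and x_dim: "\<And>m. m \<ge> 1 \<Longrightarrow> x m \<in> carrier_vec m"
    and noise: "\<And>m. m \<ge> 1 \<Longrightarrow> multivariate_normal (M m) (\<epsilon> m) (0\<^sub>v m) (\<sigma>\<^sup>2 \<cdot>\<^sub>m 1\<^sub>m m)"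
    and model: "\<And>m w. m \<ge> 1 \<Longrightarrow> w \<in> space (M m) \<Longrightarrow> y m w = A m *\<^sub>v x m + \<epsilon> m w"
    and sing: "\<And>m. m \<ge> 1 \<Longrightarrow> has_singular_values (A m) (\<gamma> m)"
    and sing_first: "\<And>m. m \<ge> 1 \<Longrightarrow> \<gamma> m 1 = 1"
    and sing_decreasing: "\<And>m i. 1 \<le> i \<Longrightarrow> i < m \<Longrightarrow> \<gamma> m (Suc i) \<le> \<gamma> m i"
    and sing_last: "\<And>m. m \<ge> 1 \<Longrightarrow> \<gamma> m m \<ge> 0"
    and x_bound: "(\<lambda>m. (l2_norm (x m))\<^sup>2) \<in> O(\<lambda>m. real m)"
  shows
    (* all expectations and suprema below exist and are finite *)
    "(\<forall>m\<ge>1.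
        (\<forall>\<alpha>\<ge>0. integrable (M m) (\<lambda>w. DP \<sigma> (A m) \<alpha> (y m w))) \<and>
        (\<forall>w\<in>space (M m). bdd_above ((\<lambda>\<alpha>. DP_deviation (M m) \<sigma> (A m) (y m) \<alpha> w) ` {0..})) \<and>
        sup_DP_deviation (M m) \<sigma> (A m) (y m) \<in> borel_measurable (M m) \<and>
        integrable (M m) (\<lambda>w. (sup_DP_deviation (M m) \<sigma> (A m) (y m) w)\<^sup>2)) \<and>
     bigO_prob M (\<lambda>m. sup_DP_deviation (M m) \<sigma> (A m) (y m)) (\<lambda>m. 1 / sqrt (real m)) \<and>
     (\<lambda>m. \<integral>w. (sup_DP_deviation (M m) \<sigma> (A m) (y m) w)\<^sup>2 \<partial>(M m)) \<in> O(\<lambda>m. 1 / real m)"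
proof -
  define S where "S = (\<lambda>m. sup_DP_deviation (M m) \<sigma> (A m) (y m))"
  \<comment> \<open>The monotone chain is followed from index 1, where the value is 1.\<close>
  have gam: "\<gamma> m j \<le> 1" if "m \<ge> 1" "j \<in> {1..m}" for m j
  proof -
    have "1 \<le> j" "j \<le> m" using that by auto
    then have "\<gamma> m j \<le> \<gamma> m 1"
    proof (induction j rule: dec_induct)
      case (step j)
      then show ?case using sing_decreasing[of j m] by simp
    qed simp
    then show ?thesis using sing_first[OF that(1)] by simp
  qed
  note bounds = prob_space.sup_DP_deviation_bounds[OF prob _ sigma A_dim x_dim noise model sing gam]
  have int: "integrable (M m) (\<lambda>w. DP \<sigma> (A m) \<alpha> (y m w))" if "m \<ge> 1" "\<alpha> \<ge> 0" for m \<alpha>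
    using that by (intro bounds(1)) auto
  have bdd: "bdd_above ((\<lambda>\<alpha>. DP_deviation (M m) \<sigma> (A m) (y m) \<alpha> w) ` {0..})"
    if "m \<ge> 1" "w \<in> space (M m)" for m w
    using that by (intro bounds(2)) auto
  have meas: "S m \<in> borel_measurable (M m)" if "m \<ge> 1" for m
    unfolding S_def using that by (intro bounds(3)) auto
  have int2: "integrable (M m) (\<lambda>w. (S m w)\<^sup>2)" if "m \<ge> 1" for m
    unfolding S_def using that by (intro bounds(4)) auto
  have moment: "(\<integral>w. (S m w)\<^sup>2 \<partial>(M m)) \<le> 8 * (2 * real m * \<sigma> ^ 4 + 4 * \<sigma>\<^sup>2 * (x m \<bullet> x m)) / (real m)\<^sup>2"
    if "m \<ge> 1" for m
    unfolding S_def using that by (intro bounds(5)) auto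
  from x_bound obtain c where c: "c > 0"
    and ev: "eventually (\<lambda>m. norm ((l2_norm (x m))\<^sup>2) \<le> c * norm (real m)) sequentially"
    by (elim landau_o.bigE)
  have bigO: "(\<lambda>m. \<integral>w. (S m w)\<^sup>2 \<partial>(M m)) \<in> O(\<lambda>m. 1 / real m)"
  proof (rule landau_o.bigI)
    show "0 < 16 * \<sigma> ^ 4 + 32 * \<sigma>\<^sup>2 * c + 1"
      using c by (intro add_nonneg_pos add_nonneg_nonneg mult_nonneg_nonneg) auto
    show "\<forall>\<^sub>F m in sequentially. norm (\<integral>w. (S m w)\<^sup>2 \<partial>(M m))
        \<le> (16 * \<sigma> ^ 4 + 32 * \<sigma>\<^sup>2 * c + 1) * norm (1 / real m)"
      using ev eventually_ge_at_top[of 1]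
    proof eventually_elim
      case (elim m)
      have xx: "x m \<bullet> x m \<le> c * real m"
        using elim(1) by (simp add: l2_norm_def scalar_prod_self_nonneg)
      have "norm (\<integral>w. (S m w)\<^sup>2 \<partial>(M m)) = (\<integral>w. (S m w)\<^sup>2 \<partial>(M m))" by simp
      also have "\<dots> \<le> 8 * (2 * real m * \<sigma> ^ 4 + 4 * \<sigma>\<^sup>2 * (x m \<bullet> x m)) / (real m)\<^sup>2"
        by (rule moment[OF elim(2)])
      also have "\<dots> \<le> 8 * (2 * real m * \<sigma> ^ 4 + 4 * \<sigma>\<^sup>2 * (c * real m)) / (real m)\<^sup>2"
        using xx by (intro divide_right_mono mult_left_mono add_left_mono) auto
      also have "\<dots> = (16 * \<sigma> ^ 4 + 32 * \<sigma>\<^sup>2 * c) * (1 / real m)"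
        using elim(2) by (simp add: field_simps power2_eq_square)
      also have "\<dots> \<le> (16 * \<sigma> ^ 4 + 32 * \<sigma>\<^sup>2 * c + 1) * norm (1 / real m)"
        by (simp add: divide_right_mono)
      finally show ?case .
    qed
  qed
  \<comment> \<open>The rate matches because the square of 1 / sqrt m is 1 / m; \<open>N=1\<close>
    is where the model starts.\<close>
  have bigP: "bigO_prob M S (\<lambda>m. 1 / sqrt (real m))"
    using bigO prob meas int2
    by (intro bigO_prob_of_second_moment[where N=1]) (auto simp: power_divide)
  show ?thesis
    by (intro conjI allI impI ballI int bdd meas[unfolded S_def] int2[unfolded S_def]
      bigP[unfolded S_def] bigO[unfolded S_def])
qed

end
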